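(* There exists $\delta>0$ such that for every integer $N\ge 4$ there exists a continuous family $\{B_V\}_{V\in G_+(4,N)}$, where each $B_V$ is a symmetric convex body in the oriented $4$-dimensional linear subspace $V\subset\mathbf{R}^N$, such that for every $V\in G_+(4,N)$ and every $4$-dimensional Euclidean ball $D\subset V$ containing the origin in its interior one has $d(B_V,D)>\delta$.
   Context: $G_+(n,N)$ is the Grassmannian of oriented $n$-dimensional linear subspaces of $\mathbf{R}^N$ (the bodies assigned to the two orientations of the same subspace may differ); each subspace carries the Euclidean structure induced from $\mathbf{R}^N$. A convex body in $V$ is a compact convex subset of $V$ with nonempty interior in $V$; it is symmetric if it is invariant under $x\mapsto -x$. A family $\{B_V\}$ of nonempty compact convex sets $B_V\subset V$ is continuous if $B_V$ depends continuously on $V$ in the Hausdorff metric (equivalently, the support function $h_{B_V}(v)=\sup\{\langle v,x\rangle: x\in B_V\}$ is continuous in the pair $(V,v)$, $v$ a unit vector of $V$). For two convex bodies $B_1,B_2$ in an $n$-dimensional space containing the origin in their interiors, $$d(B_1,B_2)=\inf\{\log(t/s)\;:\; s,t>0,\ sB_1\subseteq B_2\subseteq tB_1\},$$ where $sB$ is the image of $B$ under the homothety $x\mapsto sx$. *)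

theory Defs
  imports "HOL-Analysis.Analysis"
begin

section \<open>The spaces \<open>\<real>\<^sup>N\<close> inside one ambient type\<close>

text \<open>
  The dimension \<open>N\<close> has to be quantified inside a formula, so it cannot be a type. All the
  spaces \<open>\<real>\<^sup>N\<close> are realised as subspaces of the inner product space of finitely supported real
  sequences. (The library's norm on \<open>nat \<Rightarrow>\<^sub>0 real\<close> is the sum norm, not the
  Euclidean one, hence the separate type.)
\<close>

typedef finseq = "{f :: nat \<Rightarrow> real. finite {i. f i \<noteq> 0}}"
  morphisms coord Abs_finseq
  by (rule exI[of _ "\<lambda>_. 0"]) simp

setup_lifting type_definition_finseq

lemma finite_coord: "finite {i. coord x i \<noteq> 0}"
  using coord[of x] by simp

lemma finseq_eqI: "(\<And>i. coord x i = coord y i) \<Longrightarrow> x = y"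
  by (simp add: coord_inject[symmetric] fun_eq_iff)

instantiation finseq :: real_vector
begin

lift_definition zero_finseq :: finseq is "\<lambda>_. 0" by simp
lift_definition plus_finseq :: "finseq \<Rightarrow> finseq \<Rightarrow> finseq" is "\<lambda>x y i. x i + y i"
  subgoal for x y by (rule finite_subset[of _ "{i. x i \<noteq> 0} \<union> {i. y i \<noteq> 0}"]) auto
  done
lift_definition minus_finseq :: "finseq \<Rightarrow> finseq \<Rightarrow> finseq" is "\<lambda>x y i. x i - y i"
  subgoal for x y by (rule finite_subset[of _ "{i. x i \<noteq> 0} \<union> {i. y i \<noteq> 0}"]) auto
  done
lift_definition uminus_finseq :: "finseq \<Rightarrow> finseq" is "\<lambda>x i. - x i" by simp
lift_definition scaleR_finseq :: "real \<Rightarrow> finseq \<Rightarrow> finseq" is "\<lambda>c x i. c * x i"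
  subgoal for c x by (rule finite_subset[of _ "{i. x i \<noteq> 0}"]) auto
  done

instance
  by standard (transfer; simp add: algebra_simps fun_eq_iff)+

end

lemmas coord_simps [simp] = zero_finseq.rep_eq plus_finseq.rep_eq minus_finseq.rep_eq
  uminus_finseq.rep_eq scaleR_finseq.rep_eq

instantiation finseq :: real_inner
begin

definition inner_finseq :: "finseq \<Rightarrow> finseq \<Rightarrow> real" where
  "inner_finseq x y = (\<Sum>i | coord x i \<noteq> 0. coord x i * coord y i)"
definition norm_finseq :: "finseq \<Rightarrow> real" where
  "norm_finseq x = sqrt (inner x x)"
definition dist_finseq :: "finseq \<Rightarrow> finseq \<Rightarrow> real" where
  "dist_finseq x y = norm (x - y)"
definition sgn_finseq :: "finseq \<Rightarrow> finseq" where
  "sgn_finseq x = x /\<^sub>R norm x"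
definition uniformity_finseq :: "(finseq \<times> finseq) filter" where
  "uniformity_finseq = (INF e\<in>{0<..}. principal {(x, y). dist x y < e})"
definition open_finseq :: "finseq set \<Rightarrow> bool" where
  "open_finseq U \<longleftrightarrow> (\<forall>x\<in>U. \<forall>\<^sub>F (x', y) in uniformity. x' = x \<longrightarrow> y \<in> U)"

lemma inner_finseq_superset:
  assumes "finite S" "{i. coord x i \<noteq> 0} \<subseteq> S"
  shows "inner x y = (\<Sum>i\<in>S. coord x i * coord y i)"
  unfolding inner_finseq_def by (rule sum.mono_neutral_left) (use assms in auto)

instance
proof
  fix x y z :: finseq and r :: real
  define S where "S = {i. coord x i \<noteq> 0} \<union> {i. coord y i \<noteq> 0}"
  have S: "finite S" by (simp add: S_def finite_coord)
  have ix: "inner x w = (\<Sum>i\<in>S. coord x i * coord w i)" for w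
    by (rule inner_finseq_superset) (use S in \<open>auto simp: S_def\<close>)
  have iy: "inner y w = (\<Sum>i\<in>S. coord y i * coord w i)" for w
    by (rule inner_finseq_superset) (use S in \<open>auto simp: S_def\<close>)
  have ixy: "inner (x + y) w = (\<Sum>i\<in>S. coord (x + y) i * coord w i)" for w
    by (rule inner_finseq_superset) (use S in \<open>auto simp: S_def\<close>)
  have irx: "inner (r *\<^sub>R x) w = (\<Sum>i\<in>S. coord (r *\<^sub>R x) i * coord w i)" for w
    by (rule inner_finseq_superset) (use S in \<open>auto simp: S_def\<close>)
  show "inner x y = inner y x"
    by (simp add: ix iy mult.commute)
  show "inner (x + y) z = inner x z + inner y z"
    by (simp add: ixy ix iy algebra_simps sum.distrib)
  show "inner (r *\<^sub>R x) y = r * inner x y"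
    by (simp add: irx ix sum_distrib_left algebra_simps)
  show "0 \<le> inner x x"
    by (simp add: inner_finseq_def sum_nonneg)
  show "inner x x = 0 \<longleftrightarrow> x = 0"
    by (auto simp: inner_finseq_def sum_nonneg_eq_0_iff finite_coord intro: finseq_eqI)
qed (simp_all add: norm_finseq_def dist_finseq_def sgn_finseq_def uniformity_finseq_def
      open_finseq_def)

end

definition Rn :: "nat \<Rightarrow> finseq set" where
  "Rn N = {x. \<forall>i\<ge>N. coord x i = 0}"

lemma inner_Rn:
  assumes "x \<in> Rn N"
  shows "inner x y = (\<Sum>i<N. coord x i * coord y i)"
  by (rule inner_finseq_superset) (use assms in \<open>auto simp: Rn_def not_le[symmetric]\<close>)

section \<open>Oriented Grassmannians\<close>

text \<open>Ordered linearly independent \<open>n\<close>-tuples in \<open>E\<close>, with \<open>n = CARD('n)\<close>.\<close>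

definition frames :: "'a::real_vector set \<Rightarrow> ('a ^ 'n) set" where
  "frames E = {b. inj (\<lambda>i. b $ i) \<and> independent (range (\<lambda>i. b $ i)) \<and> range (\<lambda>i. b $ i) \<subseteq> E}"

definition ordered_bases :: "'a::real_vector set \<Rightarrow> ('a ^ 'n) set" where
  "ordered_bases V = {b \<in> frames V. span (range (\<lambda>i. b $ i)) = V}"

definition same_orientation :: "'a::real_vector set \<Rightarrow> ('a ^ 'n) rel" where
  "same_orientation V = {(b, c). b \<in> ordered_bases V \<and> c \<in> ordered_bases V \<and>
     (\<exists>A :: real ^ 'n ^ 'n. det A > 0 \<and> (\<forall>i. c $ i = (\<Sum>j\<in>UNIV. A $ i $ j *\<^sub>R b $ j)))}"

text \<open>An oriented subspace is a pair of a subspace and one of its two classes of ordered bases.\<close>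

definition oriented_grassmannian ::
    "'a::real_vector set \<Rightarrow> ('a set \<times> ('a ^ 'n) set) set" where
  "oriented_grassmannian E = {(V, \<omega>). subspace V \<and> V \<subseteq> E \<and> dim V = CARD('n) \<and>
     \<omega> \<in> ordered_bases V // same_orientation V}"

definition oriented_span :: "'a::real_vector ^ 'n \<Rightarrow> 'a set \<times> ('a ^ 'n) set" where
  "oriented_span b = (let V = span (range (\<lambda>i. b $ i)) in (V, same_orientation V `` {b}))"

text \<open>The quotient topology of the space of frames; see \<open>quotient_map_oriented_span\<close> below.\<close>

definition oriented_grassmannian_topology ::
    "'a::real_normed_vector set \<Rightarrow> ('a set \<times> ('a ^ 'n) set) topology" where
  "oriented_grassmannian_topology E = topology (\<lambda>U. U \<subseteq> oriented_grassmannian E \<and>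
     openin (top_of_set (frames E)) {b \<in> frames E. oriented_span b \<in> U})"

lemma same_orientationI:
  fixes A :: "real ^ 'n ^ 'n" and b c :: "'a::real_vector ^ 'n"
  assumes "b \<in> ordered_bases V" "c \<in> ordered_bases V" "det A > 0"
    and "\<And>i. c $ i = (\<Sum>j\<in>UNIV. A $ i $ j *\<^sub>R b $ j)"
  shows "(b, c) \<in> same_orientation V"
  unfolding same_orientation_def mem_Collect_eq case_prod_conv
  by (intro conjI exI[of _ A] allI assms)

lemma equiv_same_orientation:
  "equiv (ordered_bases V) (same_orientation V :: ('a::real_vector ^ 'n) rel)"
proof (rule equivI)
  show "same_orientation V \<subseteq> ordered_bases V \<times> (ordered_bases V :: ('a ^ 'n) set)"
    by (auto simp: same_orientation_def)
  show "refl_on (ordered_bases V) (same_orientation V :: ('a ^ 'n) rel)"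
  proof (rule refl_onI)
    fix b :: "'a ^ 'n" assume b: "b \<in> ordered_bases V"
    have mat: "b $ i = (\<Sum>j\<in>UNIV. (mat 1 :: real ^ 'n ^ 'n) $ i $ j *\<^sub>R b $ j)" for i
      by (simp add: mat_def if_distrib[of "\<lambda>c. c *\<^sub>R _"] cong: if_cong)
    show "(b, b) \<in> same_orientation V"
      by (rule same_orientationI[OF b b _ mat]) simp
  qed
  show "sym (same_orientation V :: ('a ^ 'n) rel)"
  proof (rule symI)
    fix b c :: "'a ^ 'n" assume "(b, c) \<in> same_orientation V"
    then obtain A :: "real ^ 'n ^ 'n"
      where bc: "b \<in> ordered_bases V" "c \<in> ordered_bases V" and A: "det A > 0"
        and eq: "\<And>i. c $ i = (\<Sum>j\<in>UNIV. A $ i $ j *\<^sub>R b $ j)"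
      by (auto simp: same_orientation_def)
    from A obtain A' where A': "A' ** A = mat 1"
      by (metis invertible_det_nz invertible_left_inverse less_numeral_extra(3))
    have "det A' * det A = 1"
      by (metis A' det_I det_mul)
    with A have "det A' > 0"
      by (metis zero_less_mult_pos2 zero_less_one)
    moreover have "b $ i = (\<Sum>j\<in>UNIV. A' $ i $ j *\<^sub>R c $ j)" for i
    proof -
      have "(\<Sum>j\<in>UNIV. A' $ i $ j *\<^sub>R c $ j)
          = (\<Sum>k\<in>UNIV. (A' ** A) $ i $ k *\<^sub>R b $ k)"
        unfolding eq matrix_matrix_mult_def
        by (simp add: scaleR_sum_right scaleR_sum_left) (rule sum.swap)
      also have "\<dots> = b $ i"
        by (simp add: A' mat_def if_distrib[of "\<lambda>c. c *\<^sub>R _"] cong: if_cong)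
      finally show ?thesis ..
    qed
    ultimately show "(c, b) \<in> same_orientation V"
      by (intro same_orientationI[OF bc(2,1)])
  qed
  show "trans (same_orientation V :: ('a ^ 'n) rel)"
  proof (rule transI)
    fix b c d :: "'a ^ 'n"
    assume "(b, c) \<in> same_orientation V" "(c, d) \<in> same_orientation V"
    then obtain A B :: "real ^ 'n ^ 'n"
      where bd: "b \<in> ordered_bases V" "d \<in> ordered_bases V" and AB: "det A > 0" "det B > 0"
        and eq: "\<And>i. c $ i = (\<Sum>j\<in>UNIV. A $ i $ j *\<^sub>R b $ j)"
                "\<And>i. d $ i = (\<Sum>j\<in>UNIV. B $ i $ j *\<^sub>R c $ j)"
      by (auto simp: same_orientation_def)
    have "d $ i = (\<Sum>k\<in>UNIV. (B ** A) $ i $ k *\<^sub>R b $ k)" for i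
      unfolding eq matrix_matrix_mult_def
      by (simp add: scaleR_sum_right scaleR_sum_left) (rule sum.swap)
    moreover have "det (B ** A) > 0"
      using AB by (simp add: det_mul)
    ultimately show "(b, d) \<in> same_orientation V"
      by (intro same_orientationI[OF bd])
  qed
qed

lemma oriented_span_image:
  fixes E :: "'a::real_vector set"
  assumes "subspace E"
  shows "oriented_span ` frames E = (oriented_grassmannian E :: ('a set \<times> ('a ^ 'n) set) set)"
proof (intro equalityI subsetI)
  fix p :: "'a set \<times> ('a ^ 'n) set" assume "p \<in> oriented_span ` frames E"
  then obtain b :: "'a ^ 'n" where b: "b \<in> frames E" and p: "p = oriented_span b" by blast
  define V where "V = span (range (\<lambda>i. b $ i))"
  have "b \<in> ordered_bases V"
    using b by (auto simp: ordered_bases_def frames_def V_def intro: span_base)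
  moreover have "V \<subseteq> E"
    using b assms by (auto simp: frames_def V_def dest: span_minimal)
  moreover have "dim V = CARD('n)"
    using b by (simp add: frames_def V_def dim_eq_card_independent card_image)
  ultimately show "p \<in> oriented_grassmannian E"
    by (auto simp: p oriented_span_def V_def[symmetric] oriented_grassmannian_def Let_def
        intro: quotientI) (simp add: V_def)
next
  fix p :: "'a set \<times> ('a ^ 'n) set" assume "p \<in> oriented_grassmannian E"
  then obtain V and b :: "'a ^ 'n" where V: "V \<subseteq> E" and b: "b \<in> ordered_bases V"
      and p: "p = (V, same_orientation V `` {b})"
    by (auto simp: oriented_grassmannian_def elim!: quotientE)
  from b V have "b \<in> frames E" "p = oriented_span b"
    by (auto simp: ordered_bases_def frames_def p oriented_span_def Let_def)
  then show "p \<in> oriented_span ` frames E" by blast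
qed

lemma openin_oriented_grassmannian_topology:
  fixes E :: "'a::real_normed_vector set" and U :: "('a set \<times> ('a ^ 'n) set) set"
  shows "openin (oriented_grassmannian_topology E) U \<longleftrightarrow> U \<subseteq> oriented_grassmannian E \<and>
     openin (top_of_set (frames E)) {b \<in> frames E. oriented_span b \<in> U}"
proof -
  have "istopology (\<lambda>U. U \<subseteq> (oriented_grassmannian E :: ('a set \<times> ('a ^ 'n) set) set) \<and>
     openin (top_of_set (frames E)) {b \<in> frames E. oriented_span b \<in> U})"
    unfolding istopology_def
  proof (intro conjI allI impI)
    fix S T :: "('a set \<times> ('a ^ 'n) set) set"
    have eq: "{b \<in> frames E. oriented_span b \<in> S \<inter> T} =
      {b \<in> frames E. oriented_span b \<in> S} \<inter> {b \<in> frames E. oriented_span b \<in> T}" by blast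
    assume "S \<subseteq> oriented_grassmannian E \<and> openin (top_of_set (frames E)) {b \<in> frames E. oriented_span b \<in> S}"
      "T \<subseteq> oriented_grassmannian E \<and> openin (top_of_set (frames E)) {b \<in> frames E. oriented_span b \<in> T}"
    then show "S \<inter> T \<subseteq> oriented_grassmannian E"
      "openin (top_of_set (frames E)) {b \<in> frames E. oriented_span b \<in> S \<inter> T}"
      unfolding eq by (blast, blast intro: openin_Int)
  next
    fix K :: "('a set \<times> ('a ^ 'n) set) set set"
    have eq: "{b \<in> frames E. oriented_span b \<in> \<Union>K} =
      (\<Union>S\<in>K. {b \<in> frames E. oriented_span b \<in> S})" by blast
    assume "\<forall>S\<in>K. S \<subseteq> oriented_grassmannian E \<and> openin (top_of_set (frames E)) {b \<in> frames E. oriented_span b \<in> S}"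
    then show "\<Union>K \<subseteq> oriented_grassmannian E"
      "openin (top_of_set (frames E)) {b \<in> frames E. oriented_span b \<in> \<Union>K}"
      unfolding eq by (blast, blast intro: openin_Union)
  qed
  then show ?thesis
    by (simp add: oriented_grassmannian_topology_def topology_inverse')
qed

lemma quotient_map_oriented_span:
  fixes E :: "'a::real_normed_vector set"
  assumes "subspace E"
  shows "quotient_map (top_of_set (frames E :: ('a ^ 'n) set))
    (oriented_grassmannian_topology E) oriented_span"
proof -
  have "{b \<in> frames E. oriented_span b \<in> (oriented_grassmannian E :: ('a set \<times> ('a ^ 'n) set) set)} = frames E"
    using oriented_span_image[OF assms, where 'n = 'n] by blast
  then have "openin (oriented_grassmannian_topology E) (oriented_grassmannian E :: ('a set \<times> ('a ^ 'n) set) set)"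
    by (simp only: openin_oriented_grassmannian_topology openin_subtopology_self simp_thms subset_refl)
  then have "(oriented_grassmannian E :: ('a set \<times> ('a ^ 'n) set) set)
      \<subseteq> topspace (oriented_grassmannian_topology E)"
    by (rule openin_subset)
  moreover have "topspace (oriented_grassmannian_topology E)
      \<subseteq> (oriented_grassmannian E :: ('a set \<times> ('a ^ 'n) set) set)"
    by (rule openin_oriented_grassmannian_topology[THEN iffD1, THEN conjunct1, OF openin_topspace])
  ultimately have top: "topspace (oriented_grassmannian_topology E)
      = (oriented_grassmannian E :: ('a set \<times> ('a ^ 'n) set) set)"
    by (rule subset_antisym[rotated])
  show ?thesis
    unfolding quotient_map_def top topspace_euclidean_subtopology
      openin_oriented_grassmannian_topology
    using oriented_span_image[OF assms, where 'n = 'n] by blast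
qed

section \<open>The Hausdorff metric\<close>

definition hausdorff_dist :: "'a::metric_space set \<Rightarrow> 'a set \<Rightarrow> real" where
  "hausdorff_dist A B =
     (if bounded A \<and> bounded B \<and> A \<noteq> {} \<and> B \<noteq> {}
      then max (SUP a\<in>A. infdist a B) (SUP b\<in>B. infdist b A) else 0)"

definition hausdorff_topology :: "'a::metric_space set topology" where
  "hausdorff_topology = Metric_space.mtopology {K. compact K \<and> K \<noteq> {}} hausdorff_dist"

lemma bdd_above_infdist:
  fixes A B :: "'a::metric_space set"
  assumes "bounded A" "B \<noteq> {}"
  shows "bdd_above ((\<lambda>a. infdist a B) ` A)"
proof -
  from \<open>B \<noteq> {}\<close> obtain b where b: "b \<in> B" by blast
  from \<open>bounded A\<close> obtain e where "\<And>a. a \<in> A \<Longrightarrow> dist b a \<le> e"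
    by (auto simp: bounded_any_center[where a = b])
  then have "infdist a B \<le> e" if "a \<in> A" for a
    using infdist_le[OF b, of a] that by (fastforce simp: dist_commute)
  then show ?thesis by (auto intro!: bdd_aboveI)
qed

lemma infdist_le_hausdorff_dist:
  assumes "bounded A" "bounded B" "B \<noteq> {}" "a \<in> A"
  shows "infdist a B \<le> hausdorff_dist A B"
proof -
  have "infdist a B \<le> (SUP a\<in>A. infdist a B)"
    using assms by (intro cSUP_upper bdd_above_infdist)
  then show ?thesis
    using assms by (auto simp: hausdorff_dist_def)
qed

lemma hausdorff_dist_commute: "hausdorff_dist A B = hausdorff_dist B A"
  by (auto simp: hausdorff_dist_def max.commute)

lemma hausdorff_dist_nonneg: "0 \<le> hausdorff_dist A B"
proof (cases "bounded A \<and> bounded B \<and> A \<noteq> {} \<and> B \<noteq> {}")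
  case True
  then obtain a where "a \<in> A" by blast
  then show ?thesis
    using True infdist_le_hausdorff_dist[of A B a] infdist_nonneg[of a B] by linarith
qed (auto simp: hausdorff_dist_def)

lemma Metric_space_hausdorff_dist:
  "Metric_space {K :: 'a::metric_space set. compact K \<and> K \<noteq> {}} hausdorff_dist"
proof
  fix A B :: "'a set"
  show "0 \<le> hausdorff_dist A B" by (rule hausdorff_dist_nonneg)
  show "hausdorff_dist A B = hausdorff_dist B A" by (rule hausdorff_dist_commute)
next
  fix A B :: "'a set"
  assume "A \<in> {K. compact K \<and> K \<noteq> {}}" "B \<in> {K. compact K \<and> K \<noteq> {}}"
  then have AB: "compact A" "A \<noteq> {}" "bounded A" "closed A" "compact B" "B \<noteq> {}" "bounded B" "closed B"
    by (auto simp: compact_imp_bounded compact_imp_closed)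
  show "hausdorff_dist A B = 0 \<longleftrightarrow> A = B"
  proof
    assume 0: "hausdorff_dist A B = 0"
    have "infdist a B = 0" if "a \<in> A" for a
      using infdist_le_hausdorff_dist[of A B a] infdist_nonneg[of a B] 0 AB that by simp
    moreover have "infdist b A = 0" if "b \<in> B" for b
      using infdist_le_hausdorff_dist[of B A b] infdist_nonneg[of b A] 0 AB that
      by (simp add: hausdorff_dist_commute)
    ultimately show "A = B"
      using in_closed_iff_infdist_zero[of A] in_closed_iff_infdist_zero[of B] AB by blast
  next
    assume "A = B"
    moreover have "(SUP a\<in>A. infdist a A) = (SUP a\<in>A. 0)"
      by (rule SUP_cong) auto
    ultimately show "hausdorff_dist A B = 0"
      using AB by (simp add: hausdorff_dist_def)
  qed
next
  fix A B C :: "'a set"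
  assume "A \<in> {K. compact K \<and> K \<noteq> {}}" "B \<in> {K. compact K \<and> K \<noteq> {}}" "C \<in> {K. compact K \<and> K \<noteq> {}}"
  then have *: "bounded A" "bounded B" "bounded C" "A \<noteq> {}" "B \<noteq> {}" "C \<noteq> {}" "compact A" "compact B" "compact C"
    by (auto simp: compact_imp_bounded)
  have tri: "infdist x Z \<le> hausdorff_dist X Y + hausdorff_dist Y Z"
    if "bounded X" "bounded Y" "bounded Z" "compact Y" "Y \<noteq> {}" "Z \<noteq> {}" "x \<in> X" for x and X Y Z :: "'a set"
  proof -
    have "continuous_on Y (dist x)"
      by (intro continuous_intros)
    with that obtain y where y: "y \<in> Y" "\<And>z. z \<in> Y \<Longrightarrow> dist x y \<le> dist x z"
      using continuous_attains_inf[of Y "dist x"] by blast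
    have "dist x y \<le> infdist x Y"
      using that y(2) by (auto simp: infdist_notempty intro!: cINF_greatest)
    have "infdist x Z \<le> infdist y Z + dist x y" by (rule infdist_triangle)
    moreover have "dist x y \<le> hausdorff_dist X Y"
      using infdist_le_hausdorff_dist[of X Y x] that \<open>dist x y \<le> infdist x Y\<close> by linarith
    moreover have "infdist y Z \<le> hausdorff_dist Y Z"
      using infdist_le_hausdorff_dist[of Y Z y] that y by simp
    ultimately show ?thesis by linarith
  qed
  have 1: "(SUP a\<in>A. infdist a C) \<le> hausdorff_dist A B + hausdorff_dist B C"
  proof (rule cSUP_least)
    show "infdist a C \<le> hausdorff_dist A B + hausdorff_dist B C" if "a \<in> A" for a
      by (rule tri[OF *(1,2,3,8,5,6) that])
  qed (rule *(4))
  have 2: "(SUP c\<in>C. infdist c A) \<le> hausdorff_dist A B + hausdorff_dist B C"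
  proof (rule cSUP_least)
    show "infdist c A \<le> hausdorff_dist A B + hausdorff_dist B C" if "c \<in> C" for c
      using tri[OF *(3,2,1,8,5,4) that] hausdorff_dist_commute[of C B] hausdorff_dist_commute[of B A]
      by linarith
  qed (rule *(6))
  have "hausdorff_dist A C = max (SUP a\<in>A. infdist a C) (SUP c\<in>C. infdist c A)"
    unfolding hausdorff_dist_def by (rule if_P) (intro conjI *)
  with 1 2 show "hausdorff_dist A C \<le> hausdorff_dist A B + hausdorff_dist B C"
    by linarith
qed

section \<open>Convex bodies\<close>

definition convex_body_in :: "'a::real_normed_vector set \<Rightarrow> 'a set \<Rightarrow> bool" where
  "convex_body_in V K \<longleftrightarrow>
     K \<subseteq> V \<and> compact K \<and> convex K \<and> (top_of_set V) interior_of K \<noteq> {}"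

definition origin_symmetric :: "'a::ab_group_add set \<Rightarrow> bool" where
  "origin_symmetric K \<longleftrightarrow> uminus ` K = K"

text \<open>Balls need not be centred at the origin.\<close>

definition euclidean_ball_in :: "'a::real_inner set \<Rightarrow> 'a set \<Rightarrow> bool" where
  "euclidean_ball_in V D \<longleftrightarrow> (\<exists>c\<in>V. \<exists>r>0. D = cball c r \<inter> V)"

definition homothety_dist :: "'a::real_vector set \<Rightarrow> 'a set \<Rightarrow> real" where
  "homothety_dist B1 B2 =
     Inf {ln (t / s) | s t. s > 0 \<and> t > 0 \<and> (*\<^sub>R) s ` B1 \<subseteq> B2 \<and> B2 \<subseteq> (*\<^sub>R) t ` B1}"

end

theory Submission
  imports Defs
begin

text \<open>
  Choosing an oriented orthonormal basis identifies a \<open>4\<close>-dimensional \<open>V\<close> with the quaternions, and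
  the orthogonal projections of the standard basis vectors of \<open>\<real>\<^sup>N\<close> with a spanning family
  \<open>u\<^sub>i\<close>. The imaginary parts of \<open>u\<^sub>i u\<^sub>j*\<close> and of \<open>u\<^sub>i* u\<^sub>j\<close> are vectors in
  the two \<open>3\<close>-dimensional spaces of self-dual and anti-self-dual bivectors of \<open>V\<close>; in each space they
  do not all vanish.

  Out of a finite sequence \<open>w\<^sub>k\<close> of vectors of a Euclidean \<open>3\<close>-space, not all zero, one makes a
  nonzero traceless matrix \<open>SO(3)\<close>-equivariantly by iterating
  \<open>N \<mapsto> (N N\<^sup>T + 4 a a\<^sup>T)\<^sub>0 + [w\<^sub>k]\<close>, where \<open>a\<close> is the axial vector of \<open>N\<close>, the subscript
  denotes the traceless part and \<open>[w]\<close> is the matrix of the cross product with \<open>w\<close>. The iteration never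
  returns to zero, because \<open>N N\<^sup>T + 4 a a\<^sup>T\<close> is not scalar for a traceless \<open>N \<noteq> 0\<close>. (Topologically:
  the equivariant map \<open>A \<mapsto> (A\<^sup>2)\<^sub>0\<close> of the sphere of traceless symmetric matrices is
  null-homotopic, by a homotopy that depends equivariantly on a vector; hence it extends over joins.)

  Normalising the two matrices gives a point of a compact set that is the same in every ambient dimension. With
  \<open>P\<close> and \<open>Q\<close> the two non-scalar matrices \<open>N N\<^sup>T + 4 a a\<^sup>T\<close>, and \<open>R\<^sub>x\<close> the map
  \<open>m \<mapsto> x m x*\<close> from one space of bivectors to the other, the body is the set where
  \<open>tr P tr Q |x|\<^sup>4 + \<langle>P, R\<^sub>x Q R\<^sub>x\<^sup>T\<rangle> \<le> 1\<close>. This quartic is convex, it is not constant on the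
  unit sphere, and by compactness the ratio of two of its values on the sphere exceeds a fixed number \<open>> 1\<close>.
\<close>

section \<open>Quaternions and rotations\<close>

lemma vector_4 [simp]:
  "(vector [w, x, y, z] :: 'a::zero ^ 4) $ 1 = w"
  "(vector [w, x, y, z] :: 'a::zero ^ 4) $ 2 = x"
  "(vector [w, x, y, z] :: 'a::zero ^ 4) $ 3 = y"
  "(vector [w, x, y, z] :: 'a::zero ^ 4) $ 4 = z"
  unfolding vector_def by simp_all

definition qmult :: "real ^ 4 \<Rightarrow> real ^ 4 \<Rightarrow> real ^ 4" where
  "qmult a b = vector
    [a $ 1 * b $ 1 - a $ 2 * b $ 2 - a $ 3 * b $ 3 - a $ 4 * b $ 4,
     a $ 1 * b $ 2 + a $ 2 * b $ 1 + a $ 3 * b $ 4 - a $ 4 * b $ 3,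
     a $ 1 * b $ 3 - a $ 2 * b $ 4 + a $ 3 * b $ 1 + a $ 4 * b $ 2,
     a $ 1 * b $ 4 + a $ 2 * b $ 3 - a $ 3 * b $ 2 + a $ 4 * b $ 1]"

definition qcnj :: "real ^ 4 \<Rightarrow> real ^ 4" where
  "qcnj a = vector [a $ 1, - a $ 2, - a $ 3, - a $ 4]"

definition vpart :: "real ^ 4 \<Rightarrow> real ^ 3" where
  "vpart a = vector [a $ 2, a $ 3, a $ 4]"

text \<open>The matrix of \<open>m \<mapsto> x m x*\<close> on imaginary quaternions; for non-unit \<open>x\<close> it is a rotation
  scaled by \<open>|x|\<^sup>2\<close>.\<close>

definition qrot :: "real ^ 4 \<Rightarrow> real ^ 3 ^ 3" where
  "qrot x = vector
    [vector [(x$1)\<^sup>2 + (x$2)\<^sup>2 - (x$3)\<^sup>2 - (x$4)\<^sup>2, 2 * (x$2 * x$3 - x$1 * x$4), 2 * (x$2 * x$4 + x$1 * x$3)],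
     vector [2 * (x$2 * x$3 + x$1 * x$4), (x$1)\<^sup>2 - (x$2)\<^sup>2 + (x$3)\<^sup>2 - (x$4)\<^sup>2, 2 * (x$3 * x$4 - x$1 * x$2)],
     vector [2 * (x$2 * x$4 - x$1 * x$3), 2 * (x$3 * x$4 + x$1 * x$2), (x$1)\<^sup>2 - (x$2)\<^sup>2 - (x$3)\<^sup>2 + (x$4)\<^sup>2]]"

text \<open>The self-dual part of \<open>a \<and> b\<close>; conjugating both arguments gives the anti-self-dual part.\<close>

definition bivec :: "real ^ 4 \<Rightarrow> real ^ 4 \<Rightarrow> real ^ 3" where
  "bivec a b = vpart (qmult a (qcnj b))"

definition hat :: "real ^ 3 \<Rightarrow> real ^ 3 ^ 3" where
  "hat u = vector [vector [0, - u$3, u$2], vector [u$3, 0, - u$1], vector [- u$2, u$1, 0]]"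

definition axial :: "real ^ 3 ^ 3 \<Rightarrow> real ^ 3" where
  "axial N = (1/2) *\<^sub>R vector [N$3$2 - N$2$3, N$1$3 - N$3$1, N$2$1 - N$1$2]"

definition outer :: "real ^ 3 \<Rightarrow> real ^ 3 ^ 3" where
  "outer a = (\<chi> i j. a $ i * a $ j)"

text \<open>\<open>N ** transpose N\<close> alone is scalar on the rotations by 120 degrees, which
  are traceless and nonzero. The axial term excludes such solutions.\<close>

definition sqmat :: "real ^ 3 ^ 3 \<Rightarrow> real ^ 3 ^ 3" where
  "sqmat N = N ** transpose N + 4 *\<^sub>R outer (axial N)"

definition step :: "real ^ 3 ^ 3 \<Rightarrow> real ^ 3 \<Rightarrow> real ^ 3 ^ 3" where
  "step N u = sqmat N - (trace (sqmat N) / 3) *\<^sub>R mat 1 + hat u"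

lemmas mat3_simps = vec_eq_iff forall_3 forall_4 sum_3 sum_4 matrix_matrix_mult_def
  matrix_vector_mult_def transpose_def mat_def trace_def inner_vec_def

lemma det_4:
  "det (A :: real ^ 4 ^ 4) =
    A$1$1 * A$2$2 * A$3$3 * A$4$4 + A$1$1 * A$2$3 * A$3$4 * A$4$2 + A$1$1 * A$2$4 * A$3$2 * A$4$3
  - A$1$1 * A$2$2 * A$3$4 * A$4$3 - A$1$1 * A$2$3 * A$3$2 * A$4$4 - A$1$1 * A$2$4 * A$3$3 * A$4$2
  - A$1$2 * A$2$1 * A$3$3 * A$4$4 - A$1$2 * A$2$3 * A$3$4 * A$4$1 - A$1$2 * A$2$4 * A$3$1 * A$4$3
  + A$1$2 * A$2$1 * A$3$4 * A$4$3 + A$1$2 * A$2$3 * A$3$1 * A$4$4 + A$1$2 * A$2$4 * A$3$3 * A$4$1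
  + A$1$3 * A$2$1 * A$3$2 * A$4$4 + A$1$3 * A$2$2 * A$3$4 * A$4$1 + A$1$3 * A$2$4 * A$3$1 * A$4$2
  - A$1$3 * A$2$1 * A$3$4 * A$4$2 - A$1$3 * A$2$2 * A$3$1 * A$4$4 - A$1$3 * A$2$4 * A$3$2 * A$4$1
  - A$1$4 * A$2$1 * A$3$2 * A$4$3 - A$1$4 * A$2$2 * A$3$3 * A$4$1 - A$1$4 * A$2$3 * A$3$1 * A$4$2
  + A$1$4 * A$2$1 * A$3$3 * A$4$2 + A$1$4 * A$2$2 * A$3$1 * A$4$3 + A$1$4 * A$2$3 * A$3$2 * A$4$1"
proof -
  have f1: "finite {2, 3, 4 :: 4}" "(1::4) \<notin> {2, 3, 4}" by auto
  have f2: "finite {3, 4 :: 4}" "(2::4) \<notin> {3, 4}" by auto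
  have f3: "finite {4 :: 4}" "(3::4) \<notin> {4}" by auto
  have f4: "finite ({} :: 4 set)" "(4::4) \<notin> {}" by auto
  show ?thesis
    unfolding det_def UNIV_4
    unfolding sum_over_permutations_insert[OF f1]
    unfolding sum_over_permutations_insert[OF f2]
    unfolding sum_over_permutations_insert[OF f3]
    unfolding sum_over_permutations_insert[OF f4]
    unfolding permutes_sing
    apply (simp add: sign_swap_id permutation_swap_id sign_compose sign_id permutation_compose del: sum.insert prod.insert)
    apply (simp add: Transposition.transpose_def)
    done
qed

section \<open>Products, rotations and bivectors in quaternion coordinates\<close>

lemma qrot_qmult: "qrot (qmult r x) = qrot r ** qrot x"
  by (simp add: qrot_def qmult_def mat3_simps) (algebra)

text \<open>The conjugate of \<open>r b\<close> is \<open>b* r*\<close>, so the product in question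
  is \<open>r a b* r*\<close>, whose imaginary part is that of \<open>a b*\<close> turned by
  \<open>qrot r\<close>.\<close>

lemma bivec_qmult: "bivec (qmult r a) (qmult r b) = qrot r *v bivec a b"
  by (simp add: qrot_def qmult_def qcnj_def bivec_def vpart_def mat3_simps) (algebra)

text \<open>On the anti-self-dual side left multiplication cancels: \<open>a* r* r b\<close> is
  \<open>a* b\<close> times the real number \<open>r* r\<close>.\<close>

lemma bivec_qcnj_qmult:
  "bivec (qcnj (qmult r a)) (qcnj (qmult r b)) = (norm r)\<^sup>2 *\<^sub>R bivec (qcnj a) (qcnj b)"
  unfolding power2_norm_eq_inner
  by (simp add: qmult_def qcnj_def bivec_def vpart_def mat3_simps) (algebra)

lemma norm_qmult: "norm (qmult a b) = norm a * norm b"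
proof (rule power2_eq_imp_eq)
  show "(norm (qmult a b))\<^sup>2 = (norm a * norm b)\<^sup>2"
    unfolding power_mult_distrib power2_norm_eq_inner
    by (simp add: qmult_def mat3_simps) (algebra)
qed simp_all

lemma transpose_qrot: "transpose (qrot x) ** qrot x = (norm x) ^ 4 *\<^sub>R mat 1"
proof -
  have *: "norm x ^ 4 = (inner x x)\<^sup>2"
    by (simp add: power2_norm_eq_inner[symmetric])
  show ?thesis unfolding * by (simp add: qrot_def mat3_simps) (algebra)
qed

lemma det_qrot: "det (qrot x) = norm x ^ 6"
proof -
  have "norm x ^ 6 = ((norm x)\<^sup>2) ^ 3" by simp
  then have *: "norm x ^ 6 = (inner x x) ^ 3"
    by (simp only: power2_norm_eq_inner)
  show ?thesis unfolding * det_3 by (simp add: qrot_def mat3_simps) (algebra)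
qed

lemma rotation_qrot: "norm r = 1 \<Longrightarrow> rotation_matrix (qrot r)"
  by (simp add: rotation_matrix_def orthogonal_matrix transpose_qrot det_qrot)

text \<open>The vector form of \<open>x m x*\<close>. Being built from inner and cross products, it
  shows how \<open>qrot\<close> changes when a rotation acts on the imaginary part of
  \<open>x\<close>.\<close>

lemma qrot_cross: "qrot x *v m = ((x$1)\<^sup>2 - inner (vpart x) (vpart x)) *\<^sub>R m
    + (2 * inner (vpart x) m) *\<^sub>R vpart x + (2 * x$1) *\<^sub>R cross3 (vpart x) m"
  by (simp add: qrot_def vpart_def cross3_def mat3_simps) (algebra)

lemma bivec_cross:
  "bivec a b = (b$1) *\<^sub>R vpart a - (a$1) *\<^sub>R vpart b - cross3 (vpart a) (vpart b)"
  by (simp add: qmult_def qcnj_def bivec_def vpart_def cross3_def mat3_simps)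

text \<open>The quaternion \<open>a b*\<close> has norm \<open>|a| |b|\<close> and real part
  \<open>inner a b\<close>; the rest is its imaginary part.\<close>

lemma norm_bivec: "(norm (bivec a b))\<^sup>2 = (norm a)\<^sup>2 * (norm b)\<^sup>2 - (inner a b)\<^sup>2"
  unfolding power2_norm_eq_inner
  by (simp add: qmult_def qcnj_def bivec_def vpart_def mat3_simps) (algebra)

text \<open>By Lagrange's identity the Gram determinant of \<open>a\<close> and \<open>b\<close> is
  the sum of the squares of the six two-by-two minors, which therefore all vanish.\<close>

lemma bivec_eq_0_imp: "bivec a b = 0 \<Longrightarrow> a$i * b$j = a$j * b$i"
proof -
  assume "bivec a b = 0"
  then have *: "(norm a)\<^sup>2 * (norm b)\<^sup>2 - (inner a b)\<^sup>2 = 0"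
    using norm_bivec[of a b] by simp
  have "(a$1*b$2-a$2*b$1)\<^sup>2 + (a$1*b$3-a$3*b$1)\<^sup>2 + (a$1*b$4-a$4*b$1)\<^sup>2 + (a$2*b$3-a$3*b$2)\<^sup>2
     + (a$2*b$4-a$4*b$2)\<^sup>2 + (a$3*b$4-a$4*b$3)\<^sup>2 = 0"
    using * unfolding power2_norm_eq_inner
    by (simp add: mat3_simps) (algebra)
  then have "a$1*b$2-a$2*b$1 = 0 \<and> a$1*b$3-a$3*b$1 = 0 \<and> a$1*b$4-a$4*b$1 = 0
     \<and> a$2*b$3-a$3*b$2 = 0 \<and> a$2*b$4-a$4*b$2 = 0 \<and> a$3*b$4-a$4*b$3 = 0"
    by (simp add: add_nonneg_eq_0_iff)
  then have "\<forall>i j. a$i * b$j = a$j * b$i"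
    by (simp add: forall_4) 
  then show ?thesis by blast
qed

section \<open>An equivariant iteration on traceless matrices\<close>

text \<open>For a traceless \<open>N\<close> with axial vector \<open>s e\<^sub>3\<close>, write \<open>w = a + i b\<close> and \<open>v = p + i q\<close> for
  the components of weight two and one of the symmetric part under rotations about \<open>e\<^sub>3\<close>, and \<open>2 t\<close>
  for its last diagonal entry. The hypotheses say that \<open>2 (- t + i s) w + v\<^sup>2 / 2\<close>,
  \<open>(t + i s) v + w v*\<close> and the component of weight zero vanish. Eliminating \<open>w\<close> from the first two leaves
  \<open>|v|\<^sup>4 / 2 + 2 (t\<^sup>2 + s\<^sup>2) |v|\<^sup>2 = 0\<close>.\<close>

lemma sqmat_scalar_aux:
  fixes t s p q a b :: real
  assumes w1: "- 4 * t * a - 4 * s * b + p\<^sup>2 - q\<^sup>2 = 0"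
      and w2: "2 * s * a - 2 * t * b + p * q = 0"
      and v1: "t * p - s * q + a * p + b * q = 0"
      and v2: "t * q + s * p + b * p - a * q = 0"
      and t0: "6 * t\<^sup>2 + p\<^sup>2 + q\<^sup>2 - 2 * a\<^sup>2 - 2 * b\<^sup>2 + 6 * s\<^sup>2 = 0"
    shows "t = 0 \<and> s = 0 \<and> p = 0 \<and> q = 0 \<and> a = 0 \<and> b = 0"
proof -
  have "(p\<^sup>2 + q\<^sup>2)\<^sup>2 + 4 * ((t\<^sup>2 + s\<^sup>2) * (p\<^sup>2 + q\<^sup>2)) = 0"
  proof -
    have "(p\<^sup>2 + q\<^sup>2)\<^sup>2 + 4 * ((t\<^sup>2 + s\<^sup>2) * (p\<^sup>2 + q\<^sup>2))
      = (- 4 * t * a - 4 * s * b + p\<^sup>2 - q\<^sup>2) * (p\<^sup>2 - q\<^sup>2)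
        + 4 * p * q * (2 * s * a - 2 * t * b + p * q)
        + 4 * (t * p + s * (- q)) * (t * p - s * q + a * p + b * q)
        + 4 * (t * q + s * p) * (t * q + s * p + b * p - a * q)"
      by (simp add: power2_eq_square algebra_simps)
    then show ?thesis by (simp only: w1 w2 v1 v2 mult_zero_right add_0)
  qed
  moreover have "0 \<le> (t\<^sup>2 + s\<^sup>2) * (p\<^sup>2 + q\<^sup>2)" by simp
  ultimately have "(p\<^sup>2 + q\<^sup>2)\<^sup>2 = 0"
    using zero_le_power2[of "p\<^sup>2 + q\<^sup>2"] by linarith
  then have pq: "p = 0" "q = 0" by (auto simp: sum_power2_eq_zero_iff)
  \<comment> \<open>With \<open>v = 0\<close> the weight-two equation says that
    \<open>- t + i s\<close> times \<open>w\<close> is zero, and the squared modulus is taken.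
    Weight zero then makes the two factors proportional, so both vanish.\<close>
  have "(t\<^sup>2 + s\<^sup>2) * (a\<^sup>2 + b\<^sup>2) = 0"
  proof -
    have "4 * ((t\<^sup>2 + s\<^sup>2) * (a\<^sup>2 + b\<^sup>2)) = (2 * t * a + 2 * s * b)\<^sup>2 + (2 * s * a - 2 * t * b)\<^sup>2"
      by (simp add: power2_eq_square algebra_simps)
    moreover have "2 * t * a + 2 * s * b = 0" "2 * s * a - 2 * t * b = 0" using w1 w2 unfolding pq by (simp_all add: algebra_simps)
    ultimately show ?thesis by simp
  qed
  then have "t\<^sup>2 + s\<^sup>2 = 0 \<or> a\<^sup>2 + b\<^sup>2 = 0" by simp
  moreover have "3 * (t\<^sup>2 + s\<^sup>2) = a\<^sup>2 + b\<^sup>2"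
    using t0 pq by simp
  ultimately have "t\<^sup>2 + s\<^sup>2 = 0 \<and> a\<^sup>2 + b\<^sup>2 = 0"
    by argo
  then have "t = 0" "s = 0" "a = 0" "b = 0" by (simp_all only: sum_power2_eq_zero_iff)
  with pq show ?thesis by simp
qed

text \<open>The six entries of the scalar equation combine into the hypotheses of
  \<open>sqmat_scalar_aux\<close>: the difference of the first two diagonal entries and the entry
  (1, 2) give weight two, the entries (1, 3) and (2, 3) weight one, and twice the last diagonal
  entry minus the other two gives weight zero.\<close>

lemma sqmat_scalar_imp_0_axis:
  assumes "trace N = 0" "sqmat N = \<mu> *\<^sub>R mat 1" "axial N = s *\<^sub>R axis 3 1"
  shows "N = 0"
proof -
  have a: "N$3$2 = N$2$3" "N$1$3 = N$3$1" "N$2$1 - N$1$2 = 2 * s" "N$3$3 = - N$1$1 - N$2$2"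
    using assms(1,3) by (auto simp: axial_def mat3_simps axis_def)
  have e: "sqmat N $ i $ j = (if i = j then \<mu> else 0)" for i j
    using assms(2) by (simp add: mat_def)
  note e' = e[unfolded sqmat_def assms(3)]
  define t where "t = - (N$1$1 + N$2$2) / 2"
  define a where "a = (N$1$1 - N$2$2) / 2"
  define b where "b = (N$1$2 + N$2$1) / 2"
  have n: "N$1$1 = a - t" "N$2$2 = - t - a" "N$1$2 = b - s" "N$2$1 = b + s" "N$3$3 = 2 * t"
    using a by (auto simp: t_def a_def b_def field_simps)
  note [simp] = n a(1,2)
  define p q where "p = N$3$1" and "q = N$2$3"
  note [simp] = p_def[symmetric] q_def[symmetric]
  have E: "(a - t)\<^sup>2 + (b - s)\<^sup>2 + p\<^sup>2 = \<mu>" "(b + s)\<^sup>2 + (- t - a)\<^sup>2 + q\<^sup>2 = \<mu>"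
     "p\<^sup>2 + q\<^sup>2 + (2 * t)\<^sup>2 + 4 * s\<^sup>2 = \<mu>"
     "(a - t) * (b + s) + (b - s) * (- t - a) + p * q = 0"
     "(a - t) * p + (b - s) * q + p * (2 * t) = 0"
     "(b + s) * p + (- t - a) * q + q * (2 * t) = 0"
    using e'[of 1 1] e'[of 1 2] e'[of 1 3] e'[of 2 2] e'[of 2 3] e'[of 3 3]
    by (simp_all add: mat3_simps outer_def axis_def power2_eq_square)
  have "t = 0 \<and> s = 0 \<and> p = 0 \<and> q = 0 \<and> a = 0 \<and> b = 0"
    by (rule sqmat_scalar_aux) (use E in \<open>simp add: power2_eq_square algebra_simps\<close>)+
  then show ?thesis by (simp add: vec_eq_iff forall_3)
qed

section \<open>Equivariance under conjugation by rotations\<close>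

lemma matrix_vector_mult_outer:
  "outer (R *v a) = R ** outer a ** transpose R" for R :: "real ^ 3 ^ 3"
  by (simp add: outer_def mat3_simps) (algebra)

lemma hat_mult: "hat a *v y = cross3 a y"
  by (simp add: hat_def cross3_def mat3_simps)

text \<open>Ties the axial vector to the skew part of \<open>N\<close>, so that its behaviour under
  rotations follows from that of \<open>hat\<close>.\<close>

lemma axial_eq_iff: "axial N = a \<longleftrightarrow> N - transpose N = 2 *\<^sub>R hat a"
  by (auto simp: axial_def hat_def mat3_simps)

text \<open>A rotation preserves the cross product. For an orthogonal matrix of determinant -1 a
  sign would appear.\<close>

lemma hat_rotation:
  assumes "rotation_matrix R"
  shows "hat (R *v a) = R ** hat a ** transpose R"
proof -
  have RR: "R ** transpose R = mat 1"
    using assms by (simp add: rotation_matrix_def orthogonal_matrix_def)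
  have "hat (R *v a) *v y = (R ** hat a ** transpose R) *v y" for y
  proof -
    have y: "y = R *v (transpose R *v y)"
      by (simp only: matrix_vector_mul_assoc RR matrix_vector_mul_lid)
    have "hat (R *v a) *v y = cross3 (R *v a) (R *v (transpose R *v y))"
      using y by (simp add: hat_mult)
    also have "\<dots> = R *v (hat a *v (transpose R *v y))"
      by (simp add: cross_rotation_matrix[OF assms] hat_mult)
    finally show ?thesis by (simp only: matrix_vector_mul_assoc matrix_mul_assoc)
  qed
  then show ?thesis using matrix_eq by blast
qed

lemma matrix_scaleR_simps:
  fixes A B :: "real ^ 3 ^ 3"
  shows "A ** (c *\<^sub>R B) = c *\<^sub>R (A ** B)" "(c *\<^sub>R A) ** B = c *\<^sub>R (A ** B)"
    "transpose (c *\<^sub>R A) = c *\<^sub>R transpose A" "transpose (A + B) = transpose A + transpose B"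
    "transpose (A - B) = transpose A - transpose B"
  by (simp_all add: mat3_simps algebra_simps)

lemma matrix_diff_simps:
  fixes A B C :: "real ^ 3 ^ 3"
  shows "A ** (B - C) = A ** B - A ** C" "(B - C) ** A = B ** A - C ** A" "(B + C) ** A = B ** A + C ** A"
  by (simp_all add: mat3_simps algebra_simps)

lemma axial_rotation:
  assumes "rotation_matrix R"
  shows "axial (R ** N ** transpose R) = R *v axial N"
proof -
  have "N - transpose N = 2 *\<^sub>R hat (axial N)"
    using axial_eq_iff by blast
  then have "R ** (N - transpose N) ** transpose R = 2 *\<^sub>R hat (R *v axial N)"
    by (simp add: matrix_scaleR_simps hat_rotation[OF assms])
  then show ?thesis
    unfolding axial_eq_iff
    by (simp add: matrix_transpose_mul matrix_diff_simps matrix_mul_assoc)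
qed

lemma sqmat_rotation:
  assumes "rotation_matrix R"
  shows "sqmat (R ** N ** transpose R) = R ** sqmat N ** transpose R"
proof -
  have RR: "transpose R ** R = mat 1"
    using assms by (simp add: rotation_matrix_def orthogonal_matrix_def)
  have "R ** N ** transpose R ** transpose (R ** N ** transpose R)
      = R ** N ** (transpose R ** R) ** transpose N ** transpose R"
    by (simp add: matrix_transpose_mul matrix_mul_assoc)
  also have "\<dots> = R ** (N ** transpose N) ** transpose R"
    by (simp add: RR matrix_mul_assoc)
  finally show ?thesis
    unfolding sqmat_def axial_rotation[OF assms] matrix_vector_mult_outer
    by (simp add: matrix_scaleR_simps matrix_add_ldistrib matrix_diff_simps)
qed

lemma trace_rotation:
  fixes R :: "real ^ 3 ^ 3"
  assumes "rotation_matrix R"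
  shows "trace (R ** N ** transpose R) = trace N"
proof -
  have RR: "transpose R ** R = mat 1"
    using assms by (simp add: rotation_matrix_def orthogonal_matrix_def)
  have "trace (R ** N ** transpose R) = trace (transpose R ** (R ** N))"
    by (rule trace_mul_sym)
  then show ?thesis by (simp add: matrix_mul_assoc RR)
qed

lemma step_rotation:
  assumes "rotation_matrix R"
  shows "step (R ** N ** transpose R) (R *v u) = R ** step N u ** transpose R"
proof -
  have RR: "R ** transpose R = mat 1"
    using assms by (simp add: rotation_matrix_def orthogonal_matrix_def)
  show ?thesis
    unfolding step_def sqmat_rotation[OF assms] trace_rotation[OF assms] hat_rotation[OF assms]
    by (simp add: matrix_scaleR_simps matrix_diff_simps matrix_add_ldistrib matrix_diff_simps RR)
qed

text \<open>Both hypotheses are invariant under conjugation by rotations, so the axial vector may be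
  turned onto the third coordinate axis.\<close>

theorem sqmat_scalar_imp_0:
  assumes "trace N = 0" "sqmat N = \<mu> *\<^sub>R mat 1"
  shows "N = 0"
proof -
  have "norm (axial N) = norm (norm (axial N) *\<^sub>R axis 3 1 :: real ^ 3)" by simp
  then obtain f where f: "orthogonal_transformation f" "det (matrix f) = 1"
      "f (axial N) = norm (axial N) *\<^sub>R axis 3 1"
    using rotation_exists[of "axial N" "norm (axial N) *\<^sub>R axis 3 1 :: real ^ 3"] by force
  define R where "R = matrix f"
  have R: "rotation_matrix R" "R *v axial N = norm (axial N) *\<^sub>R axis 3 1"
    using f by (auto simp: R_def rotation_matrix_def orthogonal_transformation_matrix
        matrix_works)
  have RR: "R ** transpose R = mat 1" "transpose R ** R = mat 1"
    using R by (auto simp: rotation_matrix_def orthogonal_matrix_def)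
  have "R ** N ** transpose R = 0"
  proof (rule sqmat_scalar_imp_0_axis)
    show "sqmat (R ** N ** transpose R) = \<mu> *\<^sub>R mat 1"
      by (simp add: sqmat_rotation[OF R(1)] assms matrix_scaleR_simps RR)
  qed (use R assms in \<open>auto simp: trace_rotation axial_rotation\<close>)
  then have "transpose R ** (R ** N ** transpose R) ** R = 0"
    by (simp add: mat3_simps)
  then have "(transpose R ** R) ** N ** (transpose R ** R) = 0"
    by (simp add: matrix_mul_assoc)
  then show ?thesis by (simp add: RR)
qed

section \<open>Nonvanishing of the iteration\<close>

lemma trace_step: "trace (step N u) = 0"
  by (simp add: step_def hat_def mat3_simps field_simps)

lemma transpose_sqmat: "transpose (sqmat N) = sqmat N"
  by (simp add: sqmat_def outer_def mat3_simps algebra_simps)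

text \<open>All summands of \<open>step N u\<close> except \<open>hat u\<close> are symmetric, so
  its axial vector is \<open>u\<close>. A vanishing step thus has \<open>u = 0\<close>, and then
  \<open>sqmat N\<close> is scalar.\<close>

lemma step_eq_0:
  assumes "trace N = 0" "step N u = 0"
  shows "N = 0" "u = 0"
proof -
  have sym: "sqmat N $ i $ j = sqmat N $ j $ i" for i j
  proof -
    have "sqmat N $ i $ j = transpose (sqmat N) $ j $ i" by (simp add: transpose_def)
    then show ?thesis by (simp only: transpose_sqmat)
  qed
  have u: "axial (step N u) = u"
    by (simp add: step_def axial_def hat_def mat_def vec_eq_iff forall_3
        sym[of 1 2] sym[of 1 3] sym[of 2 3])
  with assms(2) show "u = 0" by (simp add: axial_def vec_eq_iff forall_3)
  then have "hat u = 0" by (simp add: hat_def vec_eq_iff forall_3)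
  with assms(2) have "sqmat N = (trace (sqmat N) / 3) *\<^sub>R mat 1"
    by (simp add: step_def)
  with assms(1) show "N = 0" by (rule sqmat_scalar_imp_0)
qed

primrec steps :: "(nat \<Rightarrow> real ^ 3) \<Rightarrow> nat \<Rightarrow> real ^ 3 ^ 3" where
  "steps w 0 = 0"
| "steps w (Suc k) = step (steps w k) (w k)"

lemma trace_steps: "trace (steps w k) = 0"
  by (cases k) (simp_all add: trace_step, simp add: trace_def)

text \<open>Reading a nonzero vector leaves a nonzero matrix, and by \<open>step_eq_0\<close> a
  nonzero matrix stays nonzero whatever vectors follow.\<close>

lemma steps_nonzero: "j < k \<Longrightarrow> w j \<noteq> 0 \<Longrightarrow> steps w k \<noteq> 0"
proof (induction k)
  case (Suc k)
  then have "steps w k \<noteq> 0 \<or> w k \<noteq> 0"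
    by (metis less_SucE)
  then show ?case
    using step_eq_0[OF trace_steps] by (metis steps.simps(2))
qed simp

lemma steps_rotation:
  assumes "rotation_matrix R"
  shows "steps (\<lambda>k. R *v w k) n = R ** steps w n ** transpose R"
proof (induction n)
  case 0
  show ?case by (simp add: vec_eq_iff matrix_matrix_mult_def)
next
  case (Suc n)
  then show ?case by (simp only: steps.simps step_rotation[OF assms])
qed

section \<open>Continuity of the iteration\<close>

lemma continuous_on_vector_3:
  fixes f g h :: "'a::topological_space \<Rightarrow> 'b::real_normed_vector"
  assumes "continuous_on S f" "continuous_on S g" "continuous_on S h"
  shows "continuous_on S (\<lambda>x. vector [f x, g x, h x] :: 'b ^ 3)"
proof -
  have "vector [f x, g x, h x] = (\<chi> i. if i = 1 then f x else if i = 2 then g x else h x :: 'b ^ 3)" for x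
    by (simp add: vec_eq_iff forall_3)
  moreover have "continuous_on S (\<lambda>x. if i = 1 then f x else if i = 2 then g x else h x)" for i :: 3
    using assms by (cases "i = 1"; cases "i = 2") simp_all
  ultimately show ?thesis
    by (simp only: continuous_on_vec_lambda)
qed

lemma continuous_on_matrix_mult:
  fixes A :: "'a::topological_space \<Rightarrow> real ^ 'n ^ 'm" and B :: "'a \<Rightarrow> real ^ 'k ^ 'n"
  assumes "continuous_on S A" "continuous_on S B"
  shows "continuous_on S (\<lambda>x. A x ** B x)"
  unfolding matrix_matrix_mult_def
  by (rule continuous_on_vec_lambda, rule continuous_on_vec_lambda, rule continuous_on_sum)
    (rule continuous_on_mult; intro continuous_on_component assms)

lemma continuous_on_transpose:
  fixes A :: "'a::topological_space \<Rightarrow> real ^ 'n ^ 'm"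
  assumes "continuous_on S A"
  shows "continuous_on S (\<lambda>x. transpose (A x))"
  unfolding transpose_def
  by (rule continuous_on_vec_lambda, rule continuous_on_vec_lambda) (intro continuous_on_component assms)

lemma continuous_on_trace:
  fixes A :: "'a::topological_space \<Rightarrow> real ^ 'n ^ 'n"
  assumes "continuous_on S A"
  shows "continuous_on S (\<lambda>x. trace (A x))"
  unfolding trace_def by (rule continuous_on_sum) (intro continuous_on_component assms)

lemma continuous_on_sqmat:
  assumes "continuous_on S N"
  shows "continuous_on S (\<lambda>x. sqmat (N x))"
proof -
  have "continuous_on S (\<lambda>x. axial (N x))"
    unfolding axial_def
    by (rule continuous_on_scaleR, rule continuous_on_const, rule continuous_on_vector_3)
      (rule continuous_on_diff; intro continuous_on_component assms)+
  then have "continuous_on S (\<lambda>x. outer (axial (N x)))"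
    unfolding outer_def
    by (intro continuous_on_vec_lambda) (rule continuous_on_mult; rule continuous_on_component)
  then show ?thesis
    unfolding sqmat_def
    by (intro continuous_on_add continuous_on_scaleR continuous_on_const continuous_on_matrix_mult
        continuous_on_transpose assms)
qed

lemma continuous_on_step:
  assumes "continuous_on S N" "continuous_on S u"
  shows "continuous_on S (\<lambda>x. step (N x) (u x))"
proof -
  have *: "continuous_on S (\<lambda>x. hat (u x))"
    unfolding hat_def
    by (intro continuous_on_vector_3 continuous_on_minus continuous_on_component
        continuous_on_const assms)
  have "continuous_on S (\<lambda>x. trace (sqmat (N x)) * (1 / 3))"
    by (rule continuous_on_mult) (intro continuous_on_trace continuous_on_const continuous_on_sqmat assms)+
  then show ?thesis
    unfolding step_def
    by (intro continuous_on_add continuous_on_diff continuous_on_scaleR * continuous_on_sqmat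
        continuous_on_const assms) simp
qed

lemma continuous_on_steps:
  assumes "\<And>k. continuous_on S (\<lambda>x. w x k)"
  shows "continuous_on S (\<lambda>x. steps (w x) n)"
proof (induction n)
  case (Suc n)
  then show ?case unfolding steps.simps by (rule continuous_on_step) (rule assms)
qed simp

section \<open>The quartic form of a pair of matrices\<close>

lemma symmetric_entry: "transpose P = P \<Longrightarrow> P $ i $ j = P $ j $ i"
  by (metis transpose_def vec_lambda_beta)

text \<open>Five test quaternions suffice. The identity and the two cyclic permutations of the axes
  give the off-diagonal entries. A 3-4-5 rotation in the plane of the first two axes, and one
  carrying these axes into the plane of the last two, equate the diagonal entries.\<close>

lemma offdiag_qrot_eq_0_imp_scalar:
  assumes P: "transpose P = P" and H: "\<And>x. (transpose (qrot x) ** P ** qrot x) $ 1 $ 2 = 0"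
  shows "\<exists>c. P = c *\<^sub>R mat 1"
proof -
  note sP = symmetric_entry[OF P, of 2 1] symmetric_entry[OF P, of 3 1] symmetric_entry[OF P, of 3 2]
  have off: "P$1$2 = 0" "P$2$3 = 0" "P$1$3 = 0"
    using H[of "vector [1, 0, 0, 0]"] H[of "vector [1, 1, 1, 1]"] H[of "vector [1, -1, -1, -1]"]
    by (simp_all add: qrot_def matrix_matrix_mult_def transpose_def sum_3 sP)
  have "P$1$1 = P$2$2"
    using H[of "vector [2, 0, 0, 1]"]
    by (simp add: qrot_def matrix_matrix_mult_def transpose_def sum_3 sP off)
  moreover have "P$2$2 = P$3$3"
    using H[of "vector [1, 3, 1, 3]"]
    by (simp add: qrot_def matrix_matrix_mult_def transpose_def sum_3 sP off)
  ultimately have "P = (P$1$1) *\<^sub>R mat 1"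
    by (simp add: vec_eq_iff forall_3 mat_def sP off)
  then show ?thesis by blast
qed

lemma qrot_qcnj: "qrot (qcnj x) = transpose (qrot x)"
  by (simp add: qrot_def qcnj_def transpose_def vec_eq_iff forall_3)

lemma inner_matrix_trace: "(A :: real ^ 'n ^ 'm) \<bullet> B = trace (A ** transpose B)"
  by (simp add: inner_vec_def trace_def matrix_matrix_mult_def transpose_def)

lemma inner_conjugate:
  fixes P R X :: "real ^ 'n ^ 'n"
  shows "P \<bullet> (R ** X ** transpose R) = (transpose R ** P ** R) \<bullet> X"
proof -
  have "P \<bullet> (R ** X ** transpose R) = trace ((P ** R ** transpose X) ** transpose R)"
    by (simp add: inner_matrix_trace matrix_transpose_mul matrix_mul_assoc)
  also have "\<dots> = trace (transpose R ** (P ** R ** transpose X))"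
    by (rule trace_mul_sym)
  finally show ?thesis by (simp add: inner_matrix_trace matrix_mul_assoc)
qed

text \<open>Constancy survives replacing either matrix by a conjugate. If \<open>Q\<close> is not
  scalar, some conjugate \<open>Q'\<close> has a nonzero entry (1, 2). A signed sum of conjugates of
  \<open>Q'\<close> then pairs with any conjugate \<open>A\<close> of \<open>P\<close> to a nonzero
  multiple of \<open>A $ 1 $ 2\<close>, while constancy makes the signed sum of pairings zero. So
  this entry vanishes for every conjugate of \<open>P\<close>.\<close>

lemma inner_qrot_const_imp_scalar:
  fixes P Q :: "real ^ 3 ^ 3"
  assumes P: "transpose P = P" and Q: "transpose Q = Q"
    and const: "\<And>x. P \<bullet> (qrot x ** Q ** transpose (qrot x)) = norm x ^ 4 * k"
  shows "(\<exists>c. P = c *\<^sub>R mat 1) \<or> (\<exists>c. Q = c *\<^sub>R mat 1)"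
proof (rule disjCI)
  assume "\<not> (\<exists>c. Q = c *\<^sub>R mat 1)"
  then obtain z where z: "(transpose (qrot z) ** Q ** qrot z) $ 1 $ 2 \<noteq> 0"
    using offdiag_qrot_eq_0_imp_scalar[OF Q] by blast
  define y where "y = qcnj z"
  define Q' where "Q' = qrot y ** Q ** transpose (qrot y)"
  have Q'12: "Q' $ 1 $ 2 \<noteq> 0"
    using z by (simp add: Q'_def y_def qrot_qcnj)
  have "transpose Q' = Q'"
    by (simp add: Q'_def matrix_transpose_mul Q matrix_mul_assoc)
  note sQ' = symmetric_entry[OF this, of 2 1] symmetric_entry[OF this, of 3 1]
    symmetric_entry[OF this, of 3 2]
  show "\<exists>c. P = c *\<^sub>R mat 1"
  proof (rule offdiag_qrot_eq_0_imp_scalar[OF P])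
    fix x
    define A where "A = transpose (qrot x) ** P ** qrot x"
    have "transpose A = A"
      by (simp add: A_def matrix_transpose_mul P matrix_mul_assoc)
    then have sA: "A $ 2 $ 1 = A $ 1 $ 2" by (rule symmetric_entry)
    have *: "A \<bullet> (qrot g ** Q' ** transpose (qrot g)) = norm x ^ 4 * norm g ^ 4 * norm y ^ 4 * k" for g
    proof -
      have "A \<bullet> (qrot g ** Q' ** transpose (qrot g))
          = P \<bullet> (qrot (qmult (qmult x g) y) ** Q ** transpose (qrot (qmult (qmult x g) y)))"
        unfolding A_def inner_conjugate[symmetric]
        by (simp add: Q'_def qrot_qmult matrix_transpose_mul matrix_mul_assoc)
      then show ?thesis
        by (simp add: const norm_qmult power_mult_distrib)
    qed
    \<comment> \<open>The half-turns about the coordinate axes, summed with signs, isolate the entry \<open>(1, 2)\<close>.\<close>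
    define e :: "4 \<Rightarrow> real ^ 4" where "e i = axis i 1" for i
    have diag: "qrot (e 1) ** Q' ** transpose (qrot (e 1)) + qrot (e 4) ** Q' ** transpose (qrot (e 4))
       - qrot (e 2) ** Q' ** transpose (qrot (e 2)) - qrot (e 3) ** Q' ** transpose (qrot (e 3))
       = (4 * Q' $ 1 $ 2) *\<^sub>R vector [axis 2 1, axis 1 1, 0]"
      by (simp add: e_def axis_def qrot_def mat3_simps sQ')
    have "A \<bullet> (qrot (e 1) ** Q' ** transpose (qrot (e 1)) + qrot (e 4) ** Q' ** transpose (qrot (e 4))
       - qrot (e 2) ** Q' ** transpose (qrot (e 2)) - qrot (e 3) ** Q' ** transpose (qrot (e 3))) = 0"
      unfolding inner_add_right inner_diff_right * by (simp add: e_def)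
    then have "A \<bullet> vector [axis 2 1, axis 1 1, 0] = 0"
      unfolding diag using Q'12 by simp
    then show "A $ 1 $ 2 = 0"
      by (simp add: inner_vec_def sum_3 axis_def sA)
  qed
qed

section \<open>The quartic and its symmetries\<close>

definition quartic :: "real ^ 3 ^ 3 \<Rightarrow> real ^ 3 ^ 3 \<Rightarrow> real ^ 4 \<Rightarrow> real" where
  "quartic P Q x = trace P * trace Q * norm x ^ 4 + P \<bullet> (qrot x ** Q ** transpose (qrot x))"

lemma qrot_scaleR: "qrot (c *\<^sub>R x) = c\<^sup>2 *\<^sub>R qrot x"
  by (simp add: qrot_def vec_eq_iff forall_3 power2_eq_square algebra_simps)

lemma quartic_scaleR: "quartic P Q (c *\<^sub>R x) = c ^ 4 * quartic P Q x"
proof -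
  have "c ^ 4 = c\<^sup>2 * c\<^sup>2" by (simp flip: power_add)
  then show ?thesis
    by (simp add: quartic_def qrot_scaleR matrix_scaleR_simps power_mult_distrib algebra_simps)
qed

lemma inner_rotation:
  fixes R :: "real ^ 3 ^ 3"
  assumes "rotation_matrix R"
  shows "(R ** P ** transpose R) \<bullet> (R ** X ** transpose R) = P \<bullet> X"
proof -
  have RR: "transpose R ** R = mat 1"
    using assms by (simp add: rotation_matrix_def orthogonal_matrix_def)
  have "transpose R ** (R ** P ** transpose R) ** R = (transpose R ** R) ** P ** (transpose R ** R)"
    by (simp only: matrix_mul_assoc)
  then show ?thesis
    by (simp add: inner_conjugate RR)
qed

text \<open>Since \<open>qrot\<close> is multiplicative, left multiplication by \<open>r\<close>
  conjugates \<open>P\<close> and leaves \<open>Q\<close> alone, just as it rotates self-dual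
  bivectors and fixes anti-self-dual ones.\<close>

lemma quartic_qmult:
  assumes "norm r = 1"
  shows "quartic (qrot r ** P ** transpose (qrot r)) Q (qmult r x) = quartic P Q x"
proof -
  note R = rotation_qrot[OF assms]
  have "qrot (qmult r x) ** Q ** transpose (qrot (qmult r x))
      = qrot r ** (qrot x ** Q ** transpose (qrot x)) ** transpose (qrot r)"
    by (simp add: qrot_qmult matrix_transpose_mul matrix_mul_assoc)
  then show ?thesis
    by (simp add: quartic_def trace_rotation[OF R] inner_rotation[OF R] norm_qmult assms)
qed

text \<open>For a rotation \<open>S\<close> this is an automorphism of the quaternions. It fixes 1
  and acts by \<open>S\<close> on both spaces of bivectors.\<close>

definition vlift :: "real ^ 3 ^ 3 \<Rightarrow> real ^ 4 \<Rightarrow> real ^ 4" where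
  "vlift S x = vector [x $ 1, (S *v vpart x) $ 1, (S *v vpart x) $ 2, (S *v vpart x) $ 3]"

lemma vpart_vlift: "vpart (vlift S x) = S *v vpart x"
  by (simp add: vpart_def vlift_def vec_eq_iff forall_3)

lemma bivec_vlift:
  assumes "rotation_matrix S"
  shows "bivec (vlift S a) (vlift S b) = S *v bivec a b"
  unfolding bivec_cross vpart_vlift cross_rotation_matrix[OF assms]
  by (simp add: vlift_def matrix_vector_mult_diff_distrib matrix_vector_mult_scaleR)

lemma qcnj_vlift: "qcnj (vlift S a) = vlift S (qcnj a)"
  by (simp add: qcnj_def vlift_def vpart_def vec_eq_iff forall_4 matrix_vector_mult_def sum_3)

lemma inner_eq_vpart: "(x :: real ^ 4) \<bullet> y = x $ 1 * y $ 1 + vpart x \<bullet> vpart y"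
  by (simp add: inner_vec_def sum_4 sum_3 vpart_def)

lemma inner_rotation_vec:
  assumes "rotation_matrix S"
  shows "(S *v x) \<bullet> (S *v y) = x \<bullet> (y :: real ^ 3)"
proof -
  have "orthogonal_transformation ((*v) S)"
    using assms by (simp add: rotation_matrix_def orthogonal_transformation_matrix)
  then show ?thesis by (simp add: orthogonal_transformation_def)
qed

lemma norm_vlift:
  assumes "rotation_matrix S"
  shows "norm (vlift S x) = norm x"
  using inner_rotation_vec[OF assms]
  by (simp add: norm_eq_sqrt_inner inner_eq_vpart vpart_vlift) (simp add: vlift_def)

lemma qrot_vlift:
  assumes "rotation_matrix S"
  shows "qrot (vlift S x) = S ** qrot x ** transpose S"
proof -
  have SS: "S ** transpose S = mat 1"
    using assms by (simp add: rotation_matrix_def orthogonal_matrix_def)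
  have "qrot (vlift S x) *v m = (S ** qrot x ** transpose S) *v m" for m
  proof -
    have m: "S *v (transpose S *v m) = m"
      by (simp only: matrix_vector_mul_assoc SS matrix_vector_mul_lid)
    have "qrot (vlift S x) *v (S *v y) = S *v (qrot x *v y)" for y
      unfolding qrot_cross vpart_vlift inner_rotation_vec[OF assms] cross_rotation_matrix[OF assms]
      by (simp add: vlift_def matrix_vector_right_distrib matrix_vector_mult_scaleR)
    from this[of "transpose S *v m"] show ?thesis
      unfolding m by (simp only: matrix_vector_mul_assoc matrix_mul_assoc)
  qed
  then show ?thesis using matrix_eq by blast
qed

lemma quartic_vlift:
  assumes "rotation_matrix S"
  shows "quartic (S ** P ** transpose S) (S ** Q ** transpose S) (vlift S x) = quartic P Q x"
proof -
  have SS: "transpose S ** S = mat 1"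
    using assms by (simp add: rotation_matrix_def orthogonal_matrix_def)
  have "qrot (vlift S x) ** (S ** Q ** transpose S) ** transpose (qrot (vlift S x))
     = S ** qrot x ** (transpose S ** S) ** Q ** (transpose S ** S) ** transpose (qrot x) ** transpose S"
    by (simp only: qrot_vlift[OF assms] matrix_transpose_mul matrix_mul_assoc transpose_transpose)
  also have "\<dots> = S ** (qrot x ** Q ** transpose (qrot x)) ** transpose S"
    by (simp add: SS matrix_mul_assoc)
  finally show ?thesis
    by (simp add: quartic_def trace_rotation[OF assms] inner_rotation[OF assms] norm_vlift[OF assms])
qed

section \<open>Positivity and convexity of the quartic\<close>

lemma sqmat_eq_sum_outer:
  obtains v :: "real ^ 3 ^ 4" where "sqmat N = (\<Sum>i\<in>UNIV. outer (v $ i))"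
proof
  show "sqmat N = (\<Sum>i\<in>UNIV. outer
      ((vector [column 1 N, column 2 N, column 3 N, 2 *\<^sub>R axial N] :: real ^ 3 ^ 4) $ i))"
    by (simp add: sum_4 sqmat_def outer_def column_def mat3_simps)
qed

lemma trace_outer: "trace (outer a) = a \<bullet> a"
  by (simp add: trace_def outer_def inner_vec_def)

lemma inner_outer: "outer a \<bullet> (R ** outer b ** transpose R) = (a \<bullet> (R *v b))\<^sup>2"
  unfolding matrix_vector_mult_outer[symmetric]
  by (simp add: outer_def inner_vec_def power2_eq_square sum_product algebra_simps)

lemma inner_sum_outer:
  fixes v w :: "real ^ 3 ^ 4"
  shows "(\<Sum>i\<in>UNIV. outer (v $ i)) \<bullet> (R ** (\<Sum>j\<in>UNIV. outer (w $ j)) ** transpose R) =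
     (\<Sum>i\<in>UNIV. \<Sum>j\<in>UNIV. (v $ i \<bullet> (R *v (w $ j)))\<^sup>2)"
  unfolding inner_outer[symmetric]
  by (simp add: sum_4 matrix_diff_simps matrix_add_ldistrib inner_add_left inner_add_right)

text \<open>Expanding both matrices into rank-one terms reduces convexity to one pair of vectors.
  The trace term supplies for each pair the square of the Cauchy-Schwarz bound of the other
  summand.\<close>

lemma quartic_eq_sum:
  fixes v w :: "real ^ 3 ^ 4"
  assumes "P = (\<Sum>i\<in>UNIV. outer (v $ i))" "Q = (\<Sum>j\<in>UNIV. outer (w $ j))"
  shows "quartic P Q x = (\<Sum>i\<in>UNIV. \<Sum>j\<in>UNIV.
    (norm (v $ i) * norm (w $ j) * (norm x)\<^sup>2)\<^sup>2 + (v $ i \<bullet> (qrot x *v (w $ j)))\<^sup>2)"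
proof -
  have n4: "norm x ^ 4 = ((norm x)\<^sup>2)\<^sup>2" by simp
  have tr: "trace (\<Sum>i\<in>UNIV. outer (u $ i)) = (\<Sum>i\<in>UNIV. (norm (u $ i))\<^sup>2)" for u :: "real ^ 3 ^ 4"
    by (simp add: sum_4 trace_add trace_outer power2_norm_eq_inner)
  have "P \<bullet> (qrot x ** Q ** transpose (qrot x)) =
     (\<Sum>i\<in>UNIV. \<Sum>j\<in>UNIV. (v $ i \<bullet> (qrot x *v (w $ j)))\<^sup>2)"
    unfolding assms by (rule inner_sum_outer)
  moreover have "trace P * trace Q * norm x ^ 4 =
     (\<Sum>i\<in>UNIV. \<Sum>j\<in>UNIV. (norm (v $ i) * norm (w $ j) * (norm x)\<^sup>2)\<^sup>2)"
    unfolding assms tr n4 by (simp add: sum_distrib_left sum_distrib_right power_mult_distrib) (rule sum.swap)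
  ultimately show ?thesis by (simp add: quartic_def sum.distrib)
qed

lemma norm_qrot_mult: "norm (qrot x *v b) = (norm x)\<^sup>2 * norm b"
proof (rule power2_eq_imp_eq)
  have "(qrot x *v b) \<bullet> (qrot x *v b) = (transpose (qrot x) *v (qrot x *v b)) \<bullet> b"
    by (metis dot_lmul_matrix inner_commute transpose_matrix_vector)
  also have "\<dots> = norm x ^ 4 * (b \<bullet> b)"
    by (simp only: matrix_vector_mul_assoc transpose_qrot scaleR_matrix_vector_assoc[symmetric]
        matrix_vector_mul_lid inner_scaleR_left)
  finally show "(norm (qrot x *v b))\<^sup>2 = ((norm x)\<^sup>2 * norm b)\<^sup>2"
    by (simp add: power2_norm_eq_inner power_mult_distrib flip: power_mult)
       (simp add: power2_norm_eq_inner[symmetric])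
qed simp_all

lemma abs_inner_qrot_le: "\<bar>a \<bullet> (qrot x *v b)\<bar> \<le> norm a * norm b * (norm x)\<^sup>2"
  using Cauchy_Schwarz_ineq2[of a "qrot x *v b"] by (simp add: norm_qrot_mult mult_ac)

text \<open>An identity satisfied by every quadratic map. For a nonnegative quadratic form the last
  term only lowers the value, which gives convexity.\<close>

lemma qrot_convex_comb:
  "qrot ((1 - t) *\<^sub>R x + t *\<^sub>R y) = (1 - t) *\<^sub>R qrot x + t *\<^sub>R qrot y - (t * (1 - t)) *\<^sub>R qrot (x - y)"
  by (simp add: qrot_def vec_eq_iff forall_3) (algebra)

lemma norm_convex_comb:
  fixes x y :: "'a::real_inner"
  shows "(norm ((1 - t) *\<^sub>R x + t *\<^sub>R y))\<^sup>2
    = (1 - t) * (norm x)\<^sup>2 + t * (norm y)\<^sup>2 - t * (1 - t) * (norm (x - y))\<^sup>2"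
  unfolding power2_norm_eq_inner
  by (simp add: inner_add_left inner_add_right inner_diff_left inner_diff_right
      inner_commute[of y x]) (simp add: algebra_simps)

lemma convex_on_square:
  assumes "convex_on S f" "\<And>x. x \<in> S \<Longrightarrow> 0 \<le> (f x :: real)"
  shows "convex_on S (\<lambda>x. (f x)\<^sup>2)"
proof (rule convex_onI)
  show "convex S" using assms(1) by (rule convex_on_imp_convex)
  fix t x y assume t: "0 < t" "t < (1::real)" and xy: "x \<in> S" "y \<in> S"
  let ?z = "(1 - t) *\<^sub>R x + t *\<^sub>R y"
  have z: "?z \<in> S" using \<open>convex S\<close> xy t by (auto simp: convex_alt)
  have "f ?z \<le> (1 - t) * f x + t * f y"
    using assms(1) t xy by (auto simp: convex_on_def dest!: conjunct2)
  then have "(f ?z)\<^sup>2 \<le> ((1 - t) * f x + t * f y)\<^sup>2"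
    using assms(2)[OF z] by (rule power_mono)
  also have "\<dots> = (1 - t) * (f x)\<^sup>2 + t * (f y)\<^sup>2 - t * (1 - t) * (f x - f y)\<^sup>2"
    by (simp add: power2_eq_square algebra_simps)
  also have "\<dots> \<le> (1 - t) * (f x)\<^sup>2 + t * (f y)\<^sup>2"
    using t by simp
  finally show "(f ?z)\<^sup>2 \<le> (1 - t) * (f x)\<^sup>2 + t * (f y)\<^sup>2" .
qed

text \<open>Twice the function is a sum of squares of two positive semidefinite quadratic forms.\<close>

lemma convex_on_quartic_term:
  "convex_on UNIV (\<lambda>x. (norm a * norm b * (norm x)\<^sup>2)\<^sup>2 + (a \<bullet> (qrot x *v b))\<^sup>2)"
proof -
  define g where "g c x = norm a * norm b * (norm x)\<^sup>2 + c * (a \<bullet> (qrot x *v b))" for c x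
  have g: "convex_on UNIV (\<lambda>x. (g c x)\<^sup>2)" if "\<bar>c\<bar> = 1" for c
  proof (rule convex_on_square)
    show nonneg: "0 \<le> g c x" for x
      using abs_inner_qrot_le[of a x b] that unfolding g_def
      by (smt (verit, ccfv_SIG) mult_cancel_right1 mult_minus_left)
    show "convex_on UNIV (g c)"
    proof (rule convex_onI)
      fix t :: real and x y assume t: "0 < t" "t < 1"
      have "g c ((1 - t) *\<^sub>R x + t *\<^sub>R y) = (1 - t) * g c x + t * g c y - t * (1 - t) * g c (x - y)"
        unfolding g_def qrot_convex_comb norm_convex_comb
        by (simp add: matrix_vector_mult_add_rdistrib matrix_vector_mult_diff_rdistrib
            scaleR_matrix_vector_assoc[symmetric] inner_add_right inner_diff_right algebra_simps)
      also have "\<dots> \<le> (1 - t) * g c x + t * g c y"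
        using t nonneg[of "x - y"] by simp
      finally show "g c ((1 - t) *\<^sub>R x + t *\<^sub>R y) \<le> (1 - t) * g c x + t * g c y" .
    qed simp
  qed
  have "convex_on UNIV (\<lambda>x. (1/2) * ((g 1 x)\<^sup>2 + (g (-1) x)\<^sup>2))"
    by (intro convex_on_cmul convex_on_add g) auto
  moreover have "(\<lambda>x. (1/2) * ((g 1 x)\<^sup>2 + (g (-1) x)\<^sup>2))
     = (\<lambda>x. (norm a * norm b * (norm x)\<^sup>2)\<^sup>2 + (a \<bullet> (qrot x *v b))\<^sup>2)"
    by (simp add: fun_eq_iff g_def power2_eq_square algebra_simps)
  ultimately show ?thesis by (simp only:)
qed

lemma convex_on_sum':
  assumes "finite I" "convex S" "\<And>i. i \<in> I \<Longrightarrow> convex_on S (\<lambda>x. f i x :: real)"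
  shows "convex_on S (\<lambda>x. \<Sum>i\<in>I. f i x)"
  using assms by (induction I rule: finite_induct) (auto intro: convex_on_add simp: convex_on_const)

lemma convex_on_quartic: "convex_on UNIV (quartic (sqmat N) (sqmat M))"
proof -
  obtain v w :: "real ^ 3 ^ 4" where "sqmat N = (\<Sum>i\<in>UNIV. outer (v $ i))" "sqmat M = (\<Sum>j\<in>UNIV. outer (w $ j))"
    using sqmat_eq_sum_outer by metis
  note * = quartic_eq_sum[OF this]
  show ?thesis
    unfolding *[abs_def] by (intro convex_on_sum' convex_on_quartic_term) auto
qed

text \<open>The other term of the quartic is a sum of squares, because both matrices are sums of
  rank-one terms.\<close>

lemma quartic_ge: "trace (sqmat N) * trace (sqmat M) * norm x ^ 4 \<le> quartic (sqmat N) (sqmat M) x"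
proof -
  obtain v w :: "real ^ 3 ^ 4" where v: "sqmat N = (\<Sum>i\<in>UNIV. outer (v $ i))"
      and w: "sqmat M = (\<Sum>j\<in>UNIV. outer (w $ j))"
    using sqmat_eq_sum_outer by metis
  have "quartic (sqmat N) (sqmat M) x - trace (sqmat N) * trace (sqmat M) * norm x ^ 4
      = (\<Sum>i\<in>UNIV. \<Sum>j\<in>UNIV. (v $ i \<bullet> (qrot x *v (w $ j)))\<^sup>2)"
  proof -
    have "(sqmat N) \<bullet> (qrot x ** sqmat M ** transpose (qrot x)) =
       (\<Sum>i\<in>UNIV. \<Sum>j\<in>UNIV. (v $ i \<bullet> (qrot x *v (w $ j)))\<^sup>2)"
      unfolding v w by (rule inner_sum_outer)
    then show ?thesis by (simp add: quartic_def)
  qed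
  also have "\<dots> \<ge> 0" by (intro sum_nonneg) simp
  finally show ?thesis by simp
qed

lemma trace_sqmat_pos: "N \<noteq> 0 \<Longrightarrow> 0 < trace (sqmat N)"
proof -
  assume "N \<noteq> 0"
  have "trace (sqmat N) = trace (N ** transpose N) + 4 * trace (outer (axial N))"
    unfolding sqmat_def by (simp add: trace_def sum_3)
  also have "\<dots> = N \<bullet> N + 4 * (axial N \<bullet> axial N)"
    by (simp add: trace_outer inner_matrix_trace)
  also have "\<dots> > 0" using \<open>N \<noteq> 0\<close> by (intro add_pos_nonneg) auto
  finally show ?thesis .
qed

lemma quartic_pos: "N \<noteq> 0 \<Longrightarrow> M \<noteq> 0 \<Longrightarrow> x \<noteq> 0 \<Longrightarrow> 0 < quartic (sqmat N) (sqmat M) x"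
  by (rule less_le_trans[OF _ quartic_ge]) (intro mult_pos_pos trace_sqmat_pos zero_less_power; simp)

text \<open>If the quartic were constant on the unit sphere, homogeneity would make its second term
  a multiple of \<open>norm x ^ 4\<close>. Then one of the two matrices would be scalar, contrary to
  \<open>sqmat_scalar_imp_0\<close>.\<close>

lemma quartic_nonconst:
  assumes "trace N = 0" "N \<noteq> 0" "trace M = 0" "M \<noteq> 0"
  obtains x y where "norm x = 1" "norm y = 1" "quartic (sqmat N) (sqmat M) x < quartic (sqmat N) (sqmat M) y"
proof -
  define f where "f = quartic (sqmat N) (sqmat M)"
  define e :: "real ^ 4" where "e = axis 1 1"
  have e: "norm e = 1" by (simp add: e_def)
  have "\<exists>x. norm x = 1 \<and> f x \<noteq> f e"
  proof (rule ccontr)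
    assume "\<not> ?thesis"
    then have unit: "f x = f e" if "norm x = 1" for x using that by blast
    have hom: "f x = norm x ^ 4 * f e" for x
    proof (cases "x = 0")
      case True
      then show ?thesis using quartic_scaleR[of _ _ 0 0] by (simp add: f_def)
    next
      case False
      have "f x = f (norm x *\<^sub>R (x /\<^sub>R norm x))" using False by simp
      also have "\<dots> = norm x ^ 4 * f (x /\<^sub>R norm x)"
        unfolding f_def by (rule quartic_scaleR)
      also have "f (x /\<^sub>R norm x) = f e" using False by (intro unit) simp
      finally show ?thesis .
    qed
    have "sqmat N \<bullet> (qrot x ** sqmat M ** transpose (qrot x))
        = norm x ^ 4 * (f e - trace (sqmat N) * trace (sqmat M))" for x
    proof -
      have "f x = trace (sqmat N) * trace (sqmat M) * norm x ^ 4
          + sqmat N \<bullet> (qrot x ** sqmat M ** transpose (qrot x))"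
        by (simp add: f_def quartic_def)
      with hom[of x] show ?thesis by (simp add: algebra_simps)
    qed
    from inner_qrot_const_imp_scalar[OF transpose_sqmat transpose_sqmat this]
    show False using assms sqmat_scalar_imp_0 by blast
  qed
  then obtain x where "norm x = 1" "f x \<noteq> f e" by blast
  then show ?thesis
    using e that[of x e] that[of e x] unfolding f_def by (cases "f x < f e") (auto simp: f_def)
qed

section \<open>A uniform bound by compactness\<close>

lemma continuous_on_qrot:
  assumes "continuous_on S f"
  shows "continuous_on S (\<lambda>x. qrot (f x))"
  unfolding qrot_def
  by (rule continuous_on_vector_3; rule continuous_on_vector_3; intro continuous_intros assms)

lemma continuous_on_quartic:
  assumes "continuous_on S N" "continuous_on S M" "continuous_on S f"
  shows "continuous_on S (\<lambda>x. quartic (sqmat (N x)) (sqmat (M x)) (f x))"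
  unfolding quartic_def
  by (intro continuous_on_add continuous_on_mult continuous_on_trace continuous_on_sqmat
      continuous_on_inner continuous_on_matrix_mult continuous_on_transpose continuous_on_qrot
      continuous_on_power continuous_on_norm assms)

text \<open>The relatively open sets where \<open>g p x\<close> exceeds \<open>1 / (n + 1)\<close>,
  over all \<open>x\<close> and \<open>n\<close>, cover \<open>K\<close>. The largest
  \<open>n\<close> in a finite subcover gives the bound.\<close>

lemma compact_uniform_positive:
  fixes g :: "'a::topological_space \<Rightarrow> 'b \<Rightarrow> real"
  assumes "compact K" "\<And>p. p \<in> K \<Longrightarrow> \<exists>x\<in>X. 0 < g p x" "\<And>x. x \<in> X \<Longrightarrow> continuous_on K (\<lambda>p. g p x)"
  obtains \<eta> where "0 < \<eta>" "\<And>p. p \<in> K \<Longrightarrow> \<exists>x\<in>X. \<eta> < g p x"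
proof -
  define U where "U = (\<lambda>(x, n). K \<inter> (\<lambda>p. g p x) -` {inverse (real (Suc n))<..})"
  have "\<forall>z\<in>X \<times> UNIV. \<exists>V. open V \<and> U z = K \<inter> V"
  proof
    fix z assume z: "z \<in> X \<times> (UNIV :: nat set)"
    then have "openin (top_of_set K) (U z)"
      unfolding U_def using assms(3) by (cases z) (auto intro!: continuous_openin_preimage_gen)
    then show "\<exists>V. open V \<and> U z = K \<inter> V" by (simp add: openin_open)
  qed
  then obtain V where V: "\<And>z. z \<in> X \<times> UNIV \<Longrightarrow> open (V z) \<and> U z = K \<inter> V z"
    by metis
  have "K \<subseteq> (\<Union>z\<in>X \<times> UNIV. V z)"
  proof
    fix p assume p: "p \<in> K"
    then obtain x where x: "x \<in> X" "0 < g p x" using assms(2) by blast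
    then obtain n where "inverse (real (Suc n)) < g p x" using reals_Archimedean by blast
    then have "p \<in> U (x, n)" using p by (simp add: U_def)
    then show "p \<in> (\<Union>z\<in>X \<times> UNIV. V z)" using V[of "(x, n)"] x(1) by blast
  qed
  then obtain C where C: "C \<subseteq> X \<times> UNIV" "finite C" "K \<subseteq> (\<Union>z\<in>C. V z)"
    using compactE_image[OF assms(1), of "X \<times> UNIV" V] V by metis
  \<comment> \<open>Inserting 0 keeps the maximum defined for an empty subcover.\<close>
  define m where "m = Max (insert 0 (snd ` C))"
  show ?thesis
  proof
    show "0 < inverse (real (Suc m))" by simp
    fix p assume "p \<in> K"
    with C(3) obtain z where z: "z \<in> C" "p \<in> V z" by blast
    with C(1) V \<open>p \<in> K\<close> have "p \<in> U z" by blast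
    obtain x n where xn: "z = (x, n)" by (cases z)
    have "snd z \<le> m" unfolding m_def using C(2) z(1) by (intro Max_ge) auto
    then have "inverse (real (Suc m)) \<le> inverse (real (Suc n))" using xn by simp
    moreover have "inverse (real (Suc n)) < g p x" using \<open>p \<in> U z\<close> by (simp add: U_def xn)
    moreover have "x \<in> X" using C(1) z(1) xn by blast
    ultimately show "\<exists>x\<in>X. inverse (real (Suc m)) < g p x" by (metis le_less_trans)
  qed
qed

definition unit_traceless :: "(real ^ 3 ^ 3) set" where
  "unit_traceless = {N. trace N = 0 \<and> norm N = 1}"

lemma compact_unit_traceless: "compact unit_traceless"
proof -
  have eq: "unit_traceless = sphere 0 1 \<inter> {N. trace N = 0}"
    by (auto simp: unit_traceless_def)
  have "closed {N :: real ^ 3 ^ 3. trace N = 0}"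
    by (intro closed_Collect_eq continuous_on_trace continuous_intros)
  then show ?thesis
    unfolding eq by (rule compact_Int_closed[OF compact_sphere])
qed

text \<open>Compactness is applied to the ratio of two values minus one, over pairs of unit
  traceless matrices. That set of pairs involves no ambient dimension, hence neither does the
  bound.\<close>

lemma quartic_uniform_ratio:
  obtains \<eta> where "0 < \<eta>" "\<And>N M. N \<in> unit_traceless \<Longrightarrow> M \<in> unit_traceless \<Longrightarrow>
    \<exists>x y. norm x = 1 \<and> norm y = 1 \<and>
      (1 + \<eta>) * quartic (sqmat N) (sqmat M) x < quartic (sqmat N) (sqmat M) y"
proof -
  define f where "f p = quartic (sqmat (fst p)) (sqmat (snd p))" for p
  define g where "g p z = f p (snd z) / f p (fst z) - 1" for p z
  have pos: "0 < f p x" if "p \<in> unit_traceless \<times> unit_traceless" "norm x = 1" for p x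
    unfolding f_def by (rule quartic_pos) (use that in \<open>auto simp: unit_traceless_def\<close>)
  have cont: "continuous_on K (\<lambda>p. f p x)" for K x
    unfolding f_def by (intro continuous_on_quartic continuous_intros)
  obtain \<eta> where \<eta>: "0 < \<eta>" "\<And>p. p \<in> unit_traceless \<times> unit_traceless \<Longrightarrow>
      \<exists>z\<in>sphere 0 1 \<times> sphere 0 1. \<eta> < g p z"
  proof (rule compact_uniform_positive[of "unit_traceless \<times> unit_traceless" "sphere 0 1 \<times> sphere 0 1" g])
    show "compact (unit_traceless \<times> unit_traceless)"
      by (intro compact_Times compact_unit_traceless)
    show "\<exists>z\<in>sphere 0 1 \<times> sphere 0 1. 0 < g p z" if p: "p \<in> unit_traceless \<times> unit_traceless" for p
    proof -
      obtain x y where "norm x = 1" "norm y = 1" "f p x < f p y"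
        unfolding f_def
        by (rule quartic_nonconst[of "fst p" "snd p"]) (use p in \<open>auto simp: unit_traceless_def\<close>)
      then show ?thesis
        using pos[OF p, of x] by (intro bexI[of _ "(x, y)"]) (auto simp: g_def)
    qed
    show "continuous_on (unit_traceless \<times> unit_traceless) (\<lambda>p. g p z)"
      if z: "z \<in> sphere 0 1 \<times> sphere 0 1" for z
      unfolding g_def
    proof (intro continuous_on_diff continuous_on_divide cont continuous_on_const ballI)
      fix p assume "p \<in> unit_traceless \<times> unit_traceless"
      with z show "f p (fst z) \<noteq> 0" using pos[of p "fst z"] by (cases z) auto
    qed
  qed blast
  show ?thesis
  proof (rule that[OF \<eta>(1)])
    fix N M assume NM: "N \<in> unit_traceless" "M \<in> unit_traceless"
    then obtain x y where xy: "norm x = 1" "norm y = 1" "\<eta> < g (N, M) (x, y)"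
      using \<eta>(2)[of "(N, M)"] by auto
    have "0 < f (N, M) x" using pos[of "(N, M)" x] NM xy by simp
    with xy(3) have "(1 + \<eta>) * f (N, M) x < f (N, M) y"
      by (simp add: g_def field_simps)
    with xy show "\<exists>x y. norm x = 1 \<and> norm y = 1 \<and>
      (1 + \<eta>) * quartic (sqmat N) (sqmat M) x < quartic (sqmat N) (sqmat M) y"
      by (auto simp: f_def)
  qed
qed

section \<open>Invariance under rotations in dimension four\<close>

definition qmat :: "real ^ 4 \<Rightarrow> real ^ 4 ^ 4" where
  "qmat a = vector
    [vector [a $ 1, - a $ 2, - a $ 3, - a $ 4],
     vector [a $ 2, a $ 1, - a $ 4, a $ 3],
     vector [a $ 3, a $ 4, a $ 1, - a $ 2],
     vector [a $ 4, - a $ 3, a $ 2, a $ 1]]"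

lemma qmat_mult: "qmat a *v x = qmult a x"
  by (simp add: qmat_def qmult_def mat3_simps)

lemma det_qmat: "det (qmat a) = norm a ^ 4"
proof -
  have *: "norm a ^ 4 = (a \<bullet> a)\<^sup>2"
    by (simp add: power2_norm_eq_inner[symmetric])
  show ?thesis
    unfolding * det_4 by (simp add: qmat_def inner_vec_def sum_4) algebra
qed

lemma qmult_qcnj_cancel: "qmult a (qmult (qcnj a) x) = (norm a)\<^sup>2 *\<^sub>R x"
  unfolding power2_norm_eq_inner
  by (simp add: qmult_def qcnj_def vec_eq_iff forall_4 inner_vec_def sum_4) algebra

lemma norm_qcnj: "norm (qcnj a) = norm a"
  by (simp add: norm_eq_sqrt_inner inner_vec_def sum_4 qcnj_def)

text \<open>The transpose, being the inverse, also fixes the first axis. So \<open>T\<close> is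
  block diagonal, and \<open>S\<close> is its lower block.\<close>

lemma rotation_fixing_real_axis:
  assumes T: "rotation_matrix T" and 1: "T *v axis 1 1 = axis 1 1"
  obtains S where "rotation_matrix S" "\<And>x. T *v x = vlift S x"
proof -
  have TT: "transpose T ** T = mat 1" "T ** transpose T = mat 1" and det: "det T = 1"
    using T by (auto simp: rotation_matrix_def orthogonal_matrix_def)
  have col: "T $ i $ 1 = (if i = 1 then 1 else 0)" for i
  proof -
    have "(T *v axis 1 1) $ i = T $ i $ 1"
      by (simp add: matrix_vector_mult_basis column_def)
    then show ?thesis unfolding 1 by (simp add: axis_def)
  qed
  have "transpose T *v axis 1 1 = transpose T *v (T *v axis 1 1)" by (simp only: 1)
  also have "\<dots> = axis 1 1" by (simp only: matrix_vector_mul_assoc TT matrix_vector_mul_lid)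
  finally have 2: "transpose T *v axis 1 1 = axis 1 1" .
  have row: "T $ 1 $ i = (if i = 1 then 1 else 0)" for i
  proof -
    have "(transpose T *v axis 1 1) $ i = T $ 1 $ i"
      by (simp only: matrix_vector_mult_basis) (simp add: column_def transpose_def)
    then show ?thesis unfolding 2 by (simp add: axis_def)
  qed
  define S :: "real ^ 3 ^ 3" where "S = vector
    [vector [T$2$2, T$2$3, T$2$4], vector [T$3$2, T$3$3, T$3$4], vector [T$4$2, T$4$3, T$4$4]]"
  have "(transpose T ** T) $ i $ j = mat 1 $ i $ j" for i j by (simp only: TT)
  from this[of 2 2] this[of 2 3] this[of 2 4] this[of 3 3] this[of 3 4] this[of 4 4]
  have "transpose S ** S = mat 1"
    by (simp add: S_def matrix_matrix_mult_def transpose_def mat_def sum_3 sum_4 vec_eq_iff forall_3 row mult.commute)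
  moreover have "det S = det T"
    unfolding det_3 det_4 by (simp add: S_def row col)
  ultimately have "rotation_matrix S"
    by (simp add: rotation_matrix_def orthogonal_matrix det)
  moreover have "T *v x = vlift S x" for x
    by (simp add: S_def vlift_def vpart_def mat3_simps row col)
  ultimately show ?thesis by (rule that)
qed

text \<open>After multiplying by the conjugate of the image of \<open>1\<close>, the rotation fixes the real axis.\<close>

lemma rotation_4_decompose:
  fixes R :: "real ^ 4 ^ 4"
  assumes R: "rotation_matrix R"
  obtains r S where "norm r = 1" "rotation_matrix S" "\<And>x. R *v x = qmult r (vlift S x)"
proof -
  define r where "r = R *v axis 1 1"
  have iso: "norm (R *v x) = norm x" for x
    using R by (metis orthogonal_transformation_matrix rotation_matrix_def orthogonal_transformation_norm matrix_of_matrix_vector_mul matrix_vector_mul_linear)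
  have r: "norm r = 1" unfolding r_def iso by simp
  define T where "T = qmat (qcnj r) ** R"
  have Tx: "T *v x = qmult (qcnj r) (R *v x)" for x
    by (simp add: T_def matrix_vector_mul_assoc[symmetric] qmat_mult)
  have "orthogonal_transformation ((*v) T)"
    by (simp add: orthogonal_transformation Tx norm_qmult norm_qcnj r iso)
  moreover have "det T = 1"
    using R by (simp add: T_def det_mul det_qmat norm_qcnj r rotation_matrix_def)
  ultimately have T: "rotation_matrix T"
    by (simp add: rotation_matrix_def orthogonal_transformation_matrix)
  have "T *v axis 1 1 = (norm r)\<^sup>2 *\<^sub>R axis 1 1"
    unfolding Tx r_def[symmetric] power2_norm_eq_inner
    by (simp add: qmult_def qcnj_def vec_eq_iff forall_4 inner_vec_def sum_4 axis_def)
  then have "T *v axis 1 1 = axis 1 1" by (simp add: r)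
  from rotation_fixing_real_axis[OF T this] obtain S
    where S: "rotation_matrix S" "\<And>x. T *v x = vlift S x" by metis
  have "R *v x = qmult r (vlift S x)" for x
    unfolding S(2)[symmetric] Tx qmult_qcnj_cancel by (simp add: r)
  with r S(1) show ?thesis by (rule that)
qed

section \<open>The form attached to a family of vectors\<close>

definition state :: "nat \<Rightarrow> (nat \<Rightarrow> real ^ 4) \<Rightarrow> real ^ 3 ^ 3" where
  "state n u = steps (\<lambda>k. bivec (u (k div n)) (u (k mod n))) (n * n)"

text \<open>Here \<open>sgn\<close> moves nonzero states into the compact set
  \<open>unit_traceless\<close>, the same for every \<open>n\<close>. Conjugating the vectors passes
  to the anti-self-dual side.\<close>

definition form :: "nat \<Rightarrow> (nat \<Rightarrow> real ^ 4) \<Rightarrow> real ^ 4 \<Rightarrow> real" where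
  "form n u = quartic (sqmat (sgn (state n u))) (sqmat (sgn (state n (\<lambda>i. qcnj (u i)))))"

lemma state_rotation:
  assumes "rotation_matrix S" "\<And>i j. bivec (v i) (v j) = S *v bivec (u i) (u j)"
  shows "state n v = S ** state n u ** transpose S"
  unfolding state_def assms(2) by (rule steps_rotation[OF assms(1)])

lemma sgn_rotation:
  fixes S :: "real ^ 3 ^ 3"
  assumes "rotation_matrix S"
  shows "sgn (S ** N ** transpose S) = S ** sgn N ** transpose S"
  unfolding sgn_div_norm norm_eq_sqrt_inner inner_rotation[OF assms] by (simp add: matrix_scaleR_simps)

lemma form_qmult:
  assumes "norm r = 1"
  shows "form n (\<lambda>i. qmult r (u i)) (qmult r x) = form n u x"
proof -
  note R = rotation_qrot[OF assms]
  have 1: "state n (\<lambda>i. qmult r (u i)) = qrot r ** state n u ** transpose (qrot r)"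
    by (rule state_rotation[OF R]) (rule bivec_qmult)
  have 2: "state n (\<lambda>i. qcnj (qmult r (u i))) = state n (\<lambda>i. qcnj (u i))"
    by (simp add: state_def bivec_qcnj_qmult assms)
  show ?thesis
    unfolding form_def 1 2 sgn_rotation[OF R] sqmat_rotation[OF R] by (rule quartic_qmult[OF assms])
qed

lemma form_vlift:
  assumes "rotation_matrix S"
  shows "form n (\<lambda>i. vlift S (u i)) (vlift S x) = form n u x"
proof -
  have 1: "state n (\<lambda>i. vlift S (v i)) = S ** state n v ** transpose S" for v
    by (rule state_rotation[OF assms]) (rule bivec_vlift[OF assms])
  show ?thesis
    unfolding form_def qcnj_vlift 1 sgn_rotation[OF assms] sqmat_rotation[OF assms]
    by (rule quartic_vlift[OF assms])
qed

text \<open>This makes the body independent of the oriented orthonormal basis chosen in its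
  subspace.\<close>

theorem form_rotation:
  assumes "rotation_matrix R"
  shows "form n (\<lambda>i. R *v u i) (R *v x) = form n u x"
proof -
  obtain r S where "norm r = 1" "rotation_matrix S" "\<And>x. R *v x = qmult r (vlift S x)"
    using rotation_4_decompose[OF assms] by metis
  then show ?thesis by (simp add: form_qmult form_vlift)
qed

text \<open>The pair \<open>(i, j)\<close> is read at position \<open>i * n + j\<close>, from which
  division by \<open>n\<close> recovers it because \<open>j < n\<close>.\<close>

lemma state_nonzero:
  assumes "i < n" "j < n" "bivec (u i) (u j) \<noteq> 0"
  shows "state n u \<noteq> 0"
  unfolding state_def
proof (rule steps_nonzero)
  show "i * n + j < n * n"
  proof -
    have "i * n + j < Suc i * n" using assms by simp
    also have "\<dots> \<le> n * n" using assms by (intro mult_le_mono1) simp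
    finally show ?thesis .
  qed
  show "bivec (u ((i * n + j) div n)) (u ((i * n + j) mod n)) \<noteq> 0"
    using assms by simp
qed

lemma trace_scaleR: "trace (c *\<^sub>R A) = c * trace (A :: real ^ 'n ^ 'n)"
  by (simp add: trace_def sum_distrib_left)

lemma sgn_state_unit_traceless: "state n u \<noteq> 0 \<Longrightarrow> sgn (state n u) \<in> unit_traceless"
  by (simp add: unit_traceless_def norm_sgn)
    (simp add: sgn_div_norm trace_scaleR state_def trace_steps)

lemma bivec_qcnj_eq_0_imp: "bivec (qcnj a) (qcnj b) = 0 \<Longrightarrow> a $ 1 * b $ 2 = a $ 2 * b $ 1"
  using bivec_eq_0_imp[of "qcnj a" "qcnj b" 1 2] by (simp add: qcnj_def)

text \<open>Comparing two coordinates suffices, since the coordinate functions come from an orthonormal frame.\<close>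

definition spanning :: "nat \<Rightarrow> (nat \<Rightarrow> real ^ 4) \<Rightarrow> bool" where
  "spanning n u \<longleftrightarrow> (\<exists>i<n. \<exists>j<n. u i $ 1 * u j $ 2 \<noteq> u i $ 2 * u j $ 1)"

lemma spanning_imp_state:
  assumes "spanning n u"
  shows "sgn (state n u) \<in> unit_traceless" "sgn (state n (\<lambda>i. qcnj (u i))) \<in> unit_traceless"
proof -
  obtain i j where ij: "i < n" "j < n" "u i $ 1 * u j $ 2 \<noteq> u i $ 2 * u j $ 1"
    using assms by (auto simp: spanning_def)
  show "sgn (state n u) \<in> unit_traceless"
    by (rule sgn_state_unit_traceless, rule state_nonzero[OF ij(1,2)]) (use ij bivec_eq_0_imp in blast)
  show "sgn (state n (\<lambda>i. qcnj (u i))) \<in> unit_traceless"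
    by (rule sgn_state_unit_traceless, rule state_nonzero[OF ij(1,2)]) (use ij bivec_qcnj_eq_0_imp in blast)
qed

lemma continuous_on_bivec:
  assumes "continuous_on S f" "continuous_on S g"
  shows "continuous_on S (\<lambda>x. bivec (f x) (g x))"
  unfolding bivec_cross vpart_def cross3_def
  by (intro continuous_on_diff continuous_on_scaleR continuous_on_mult continuous_on_vector_3
      continuous_on_component assms)

lemma continuous_on_qcnj:
  assumes "continuous_on S f"
  shows "continuous_on S (\<lambda>x. qcnj (f x))"
proof -
  have "qcnj a = (\<chi> i. if i = 1 then a $ i else - a $ i)" for a
    by (simp add: qcnj_def vec_eq_iff forall_4)
  moreover have "continuous_on S (\<lambda>x. if i = 1 then f x $ i else - f x $ i)" for i
    using assms by (cases "i = 1") (auto intro!: continuous_intros)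
  ultimately show ?thesis by (simp only: continuous_on_vec_lambda)
qed

text \<open>The spanning condition keeps both states away from zero, the point where
  \<open>sgn\<close> is discontinuous.\<close>

lemma continuous_on_form:
  assumes u: "\<And>i. continuous_on S (\<lambda>z. u z i)" and f: "continuous_on S f"
    and span: "\<And>z. z \<in> S \<Longrightarrow> spanning n (u z)"
  shows "continuous_on S (\<lambda>z. form n (u z) (f z))"
proof -
  have st: "continuous_on S (\<lambda>z. state n (v z))" if "\<And>i. continuous_on S (\<lambda>z. v z i)" for v
    unfolding state_def by (intro continuous_on_steps continuous_on_bivec that)
  have nz: "state n (u z) \<noteq> 0" "state n (\<lambda>i. qcnj (u z i)) \<noteq> 0" if "z \<in> S" for z
    using spanning_imp_state[OF span[OF that]] by (auto simp: unit_traceless_def)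
  show ?thesis
    unfolding form_def
    by (intro continuous_on_quartic continuous_on_sgn st continuous_on_qcnj u f ballI nz)
qed

lemma form_scaleR: "form n u (c *\<^sub>R x) = c ^ 4 * form n u x"
  by (simp add: form_def quartic_scaleR)

lemma form_pos: "spanning n u \<Longrightarrow> x \<noteq> 0 \<Longrightarrow> 0 < form n u x"
  unfolding form_def using spanning_imp_state[of n u] by (intro quartic_pos) (auto simp: unit_traceless_def)

lemma convex_on_form: "convex_on UNIV (form n u)"
  by (simp add: form_def convex_on_quartic)

section \<open>Orthonormal frames\<close>

definition gram_schmidt :: "'a::real_inner ^ 4 \<Rightarrow> 'a ^ 4" where
  "gram_schmidt b =
    (let e1 = sgn (b $ 1);
         e2 = sgn (b $ 2 - (b $ 2 \<bullet> e1) *\<^sub>R e1);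
         e3 = sgn (b $ 3 - (b $ 3 \<bullet> e1) *\<^sub>R e1 - (b $ 3 \<bullet> e2) *\<^sub>R e2);
         e4 = sgn (b $ 4 - (b $ 4 \<bullet> e1) *\<^sub>R e1 - (b $ 4 \<bullet> e2) *\<^sub>R e2 - (b $ 4 \<bullet> e3) *\<^sub>R e3)
     in vector [e1, e2, e3, e4])"

definition orthonormal_frame :: "'a::real_inner ^ 'n \<Rightarrow> bool" where
  "orthonormal_frame e \<longleftrightarrow> (\<forall>i j. e $ i \<bullet> e $ j = (if i = j then 1 else 0))"

definition lincomb :: "'a::real_vector ^ 'n \<Rightarrow> real ^ 'n \<Rightarrow> 'a" where
  "lincomb e x = (\<Sum>i\<in>UNIV. x $ i *\<^sub>R e $ i)"

lemma linear_lincomb: "linear (lincomb e)"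
  by (rule linearI) (simp_all add: lincomb_def algebra_simps sum.distrib scaleR_sum_right)

lemma lincomb_axis: "lincomb e (axis i 1) = e $ i"
  by (simp add: lincomb_def axis_def if_distrib[of "\<lambda>c. c *\<^sub>R _"] cong: if_cong)

lemma range_lincomb: "range (lincomb e) = span (range (\<lambda>i. e $ i))"
proof
  show "range (lincomb e) \<subseteq> span (range (\<lambda>i. e $ i))"
    by (auto simp: lincomb_def intro!: span_sum span_scale intro: span_base)
  have "subspace (range (lincomb e))"
    by (rule linear_subspace_image[OF linear_lincomb]) simp
  then show "span (range (\<lambda>i. e $ i)) \<subseteq> range (lincomb e)"
    by (intro span_minimal) (auto simp: lincomb_axis[symmetric])
qed

lemma inner_lincomb:
  assumes "orthonormal_frame e"
  shows "lincomb e x \<bullet> lincomb e y = x \<bullet> y"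
proof -
  have "e $ i \<bullet> e $ j = (if i = j then 1 else 0)" for i j
    using assms by (simp add: orthonormal_frame_def)
  then show ?thesis
    by (simp add: lincomb_def inner_sum_left inner_sum_right inner_vec_def
        mult.commute if_distrib[of "(*) _"] cong: if_cong)
qed

lemma norm_lincomb: "orthonormal_frame e \<Longrightarrow> norm (lincomb e x) = norm x"
  by (simp add: norm_eq_sqrt_inner inner_lincomb)

lemma orthonormal_frame_in_frames:
  assumes "orthonormal_frame e" "range (\<lambda>i. e $ i) \<subseteq> E"
  shows "e \<in> frames E"
proof -
  have e: "e $ i \<bullet> e $ j = (if i = j then 1 else 0)" for i j
    using assms(1) by (simp add: orthonormal_frame_def)
  have "inj (\<lambda>i. e $ i)"
    by (rule injI) (metis e zero_neq_one)
  moreover have "independent (range (\<lambda>i. e $ i))"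
  proof (rule pairwise_orthogonal_independent)
    show "pairwise orthogonal (range (\<lambda>i. e $ i))"
      by (auto simp: pairwise_def orthogonal_def e)
    show "0 \<notin> range (\<lambda>i. e $ i)"
      using e by (metis imageE inner_zero_left zero_neq_one)
  qed
  ultimately show ?thesis using assms(2) by (simp add: frames_def)
qed

lemma frame_not_in_span:
  assumes "b \<in> frames E" "k \<notin> I"
  shows "b $ k \<notin> span ((\<lambda>i. b $ i) ` I)"
proof
  assume "b $ k \<in> span ((\<lambda>i. b $ i) ` I)"
  moreover have "(\<lambda>i. b $ i) ` I \<subseteq> range (\<lambda>i. b $ i) - {b $ k}"
    using assms by (auto simp: frames_def dest: injD)
  ultimately have "b $ k \<in> span (range (\<lambda>i. b $ i) - {b $ k})"
    using span_mono by blast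
  then show False
    using assms(1) by (auto simp: frames_def dependent_def)
qed

text \<open>The coefficient vectors \<open>r\<^sub>i\<close> of the orthonormalised frame form a lower triangular matrix.\<close>

lemma gram_schmidt_steps:
  fixes b :: "'a::real_inner ^ 4"
  assumes b: "b \<in> frames E"
  obtains A :: "real ^ 4 ^ 4" where "det A > 0" "\<And>i. gram_schmidt b $ i = lincomb b (A $ i)"
    "orthonormal_frame (gram_schmidt b)"
proof -
  interpret L: linear "lincomb b" by (rule linear_lincomb)
  define e1 where "e1 = sgn (b $ 1)"
  define g2 where "g2 = b $ 2 - (b $ 2 \<bullet> e1) *\<^sub>R e1"
  define e2 where "e2 = sgn g2"
  define g3 where "g3 = b $ 3 - (b $ 3 \<bullet> e1) *\<^sub>R e1 - (b $ 3 \<bullet> e2) *\<^sub>R e2"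
  define e3 where "e3 = sgn g3"
  define g4 where "g4 = b $ 4 - (b $ 4 \<bullet> e1) *\<^sub>R e1 - (b $ 4 \<bullet> e2) *\<^sub>R e2 - (b $ 4 \<bullet> e3) *\<^sub>R e3"
  define e4 where "e4 = sgn g4"
  have gs: "gram_schmidt b = vector [e1, e2, e3, e4]"
    by (simp add: gram_schmidt_def e1_def e2_def e3_def e4_def g2_def g3_def g4_def Let_def)
  have base: "b $ i \<in> span ((\<lambda>i. b $ i) ` I)" if "i \<in> I" for i I
    using that by (intro span_base imageI)
  have s1: "e1 \<in> span ((\<lambda>i. b $ i) ` I)" if "1 \<in> I" for I
    unfolding e1_def sgn_div_norm by (intro span_scale base that)
  have s2: "e2 \<in> span ((\<lambda>i. b $ i) ` I)" if "1 \<in> I" "2 \<in> I" for I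
    unfolding e2_def sgn_div_norm g2_def by (intro span_scale span_diff base s1 that)
  have s3: "e3 \<in> span ((\<lambda>i. b $ i) ` I)" if "1 \<in> I" "2 \<in> I" "3 \<in> I" for I
    unfolding e3_def sgn_div_norm g3_def by (intro span_scale span_diff base s1 s2 that)
  have n1: "b $ 1 \<noteq> 0"
    using frame_not_in_span[OF b, of 1 "{}"] by auto
  have n2: "g2 \<noteq> 0"
  proof
    assume "g2 = 0"
    then have "b $ 2 = (b $ 2 \<bullet> e1) *\<^sub>R e1" by (simp add: g2_def)
    also have "\<dots> \<in> span ((\<lambda>i. b $ i) ` {1})" by (intro span_scale s1) simp
    finally show False using frame_not_in_span[OF b, of 2 "{1}"] by auto
  qed
  have n3: "g3 \<noteq> 0"
  proof
    assume "g3 = 0"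
    then have "b $ 3 = (b $ 3 \<bullet> e1) *\<^sub>R e1 + (b $ 3 \<bullet> e2) *\<^sub>R e2" by (simp add: g3_def algebra_simps)
    also have "\<dots> \<in> span ((\<lambda>i. b $ i) ` {1, 2})"
      by (intro span_add span_scale s1 s2) simp_all
    finally show False using frame_not_in_span[OF b, of 3 "{1, 2}"] by auto
  qed
  have n4: "g4 \<noteq> 0"
  proof
    assume "g4 = 0"
    then have "b $ 4 = (b $ 4 \<bullet> e1) *\<^sub>R e1 + (b $ 4 \<bullet> e2) *\<^sub>R e2 + (b $ 4 \<bullet> e3) *\<^sub>R e3"
      by (simp add: g4_def algebra_simps)
    also have "\<dots> \<in> span ((\<lambda>i. b $ i) ` {1, 2, 3})"
      by (intro span_add span_scale s1 s2 s3) simp_all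
    finally show False using frame_not_in_span[OF b, of 4 "{1, 2, 3}"] by auto
  qed
  have unit: "e1 \<bullet> e1 = 1" "e2 \<bullet> e2 = 1" "e3 \<bullet> e3 = 1" "e4 \<bullet> e4 = 1"
    using n1 n2 n3 n4 by (simp_all add: e1_def e2_def e3_def e4_def norm_sgn flip: norm_eq_1)
  have 21: "e2 \<bullet> e1 = 0"
    by (simp add: e2_def sgn_div_norm g2_def inner_diff_left unit)
  have 31: "e3 \<bullet> e1 = 0" "e3 \<bullet> e2 = 0"
    by (simp_all add: e3_def sgn_div_norm g3_def inner_diff_left unit 21 inner_commute[of e1 e2])
  have 41: "e4 \<bullet> e1 = 0" "e4 \<bullet> e2 = 0" "e4 \<bullet> e3 = 0"
    by (simp_all add: e4_def sgn_div_norm g4_def inner_diff_left unit 21 31 inner_commute[of e1 e2]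
        inner_commute[of e1 e3] inner_commute[of e2 e3])
  have orth: "orthonormal_frame (gram_schmidt b)"
    unfolding orthonormal_frame_def gs
    using unit 21 31 41 by (simp add: forall_4 inner_commute)
  define r1 :: "real ^ 4" where "r1 = inverse (norm (b $ 1)) *\<^sub>R axis 1 1"
  define r2 where "r2 = inverse (norm g2) *\<^sub>R (axis 2 1 - (b $ 2 \<bullet> e1) *\<^sub>R r1)"
  define r3 where "r3 = inverse (norm g3) *\<^sub>R (axis 3 1 - (b $ 3 \<bullet> e1) *\<^sub>R r1 - (b $ 3 \<bullet> e2) *\<^sub>R r2)"
  define r4 where "r4 = inverse (norm g4) *\<^sub>R
    (axis 4 1 - (b $ 4 \<bullet> e1) *\<^sub>R r1 - (b $ 4 \<bullet> e2) *\<^sub>R r2 - (b $ 4 \<bullet> e3) *\<^sub>R r3)"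
  have L1: "lincomb b r1 = e1"
    by (simp add: r1_def L.scale lincomb_axis e1_def sgn_div_norm)
  have L2: "lincomb b r2 = e2"
    by (simp add: r2_def L.scale L.diff lincomb_axis L1 e2_def g2_def sgn_div_norm)
  have L3: "lincomb b r3 = e3"
    by (simp add: r3_def L.scale L.diff lincomb_axis L1 L2 e3_def g3_def sgn_div_norm)
  have L4: "lincomb b r4 = e4"
    by (simp add: r4_def L.scale L.diff lincomb_axis L1 L2 L3 e4_def g4_def sgn_div_norm)
  show ?thesis
  proof (rule that)
    have z: "r1 $ 2 = 0" "r1 $ 3 = 0" "r1 $ 4 = 0" by (simp_all add: r1_def axis_def)
    have z2: "r2 $ 3 = 0" "r2 $ 4 = 0" by (simp_all add: r2_def axis_def z)
    have z3: "r3 $ 4 = 0" by (simp add: r3_def axis_def z z2)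
    have d: "0 < r1 $ 1" "0 < r2 $ 2" "0 < r3 $ 3" "0 < r4 $ 4"
      using n1 n2 n3 n4 by (simp_all add: r1_def r2_def r3_def r4_def axis_def z z2 z3)
    show "det (vector [r1, r2, r3, r4] :: real ^ 4 ^ 4) > 0"
      unfolding det_4 using d by (simp add: z z2 z3)
    have "\<forall>i. gram_schmidt b $ i = lincomb b ((vector [r1, r2, r3, r4] :: real ^ 4 ^ 4) $ i)"
      unfolding forall_4 gs by (simp add: L1 L2 L3 L4)
    then show "gram_schmidt b $ i = lincomb b ((vector [r1, r2, r3, r4] :: real ^ 4 ^ 4) $ i)" for i
      by blast
  qed (rule orth)
qed

lemma orthonormal_gram_schmidt: "b \<in> frames E \<Longrightarrow> orthonormal_frame (gram_schmidt b)"
  by (erule gram_schmidt_steps)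

text \<open>The triangular matrix of \<open>gram_schmidt_steps\<close> has positive determinant,
  which is the orientation condition; its inverse gives the reverse inclusion of spans.\<close>

lemma gram_schmidt_same_orientation:
  fixes b :: "'a::real_inner ^ 4"
  assumes b: "b \<in> frames E" and V: "V = span (range (\<lambda>i. b $ i))"
  shows "(b, gram_schmidt b) \<in> same_orientation V"
proof -
  obtain A :: "real ^ 4 ^ 4" where A: "det A > 0" "\<And>i. gram_schmidt b $ i = lincomb b (A $ i)"
    and orth: "orthonormal_frame (gram_schmidt b)"
    by (rule gram_schmidt_steps[OF b]) blast
  obtain A' where A': "A' ** A = mat 1"
    using A(1) by (metis invertible_det_nz invertible_left_inverse less_numeral_extra(3))
  have comp: "lincomb (gram_schmidt b) x = lincomb b (x v* A)" for x
  proof -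
    have "lincomb (gram_schmidt b) x = (\<Sum>i\<in>UNIV. \<Sum>j\<in>UNIV. (x $ i * A $ i $ j) *\<^sub>R b $ j)"
      unfolding lincomb_def[of "gram_schmidt b"] A(2) unfolding lincomb_def
      by (simp add: scaleR_sum_right)
    also have "\<dots> = (\<Sum>j\<in>UNIV. \<Sum>i\<in>UNIV. (x $ i * A $ i $ j) *\<^sub>R b $ j)"
      by (rule sum.swap)
    also have "\<dots> = lincomb b (x v* A)"
      by (simp add: lincomb_def vector_matrix_mult_def scaleR_sum_left mult.commute)
    finally show ?thesis .
  qed
  have V': "span (range (\<lambda>i. gram_schmidt b $ i)) = V"
  proof
    show "span (range (\<lambda>i. gram_schmidt b $ i)) \<subseteq> V"
      unfolding V range_lincomb[symmetric] by (rule image_subsetI) (simp only: comp rangeI)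
    have inv: "lincomb b x = lincomb (gram_schmidt b) (x v* A')" for x
      by (simp only: comp vector_matrix_mul_assoc A' vector_matrix_mul_rid)
    show "V \<subseteq> span (range (\<lambda>i. gram_schmidt b $ i))"
      unfolding V range_lincomb[symmetric] by (rule image_subsetI) (simp only: inv rangeI)
  qed
  show ?thesis
  proof (rule same_orientationI[OF _ _ A(1)])
    show "b \<in> ordered_bases V"
      using b unfolding ordered_bases_def frames_def V by (auto intro: span_base)
    show "gram_schmidt b \<in> ordered_bases V"
      unfolding ordered_bases_def V'[symmetric]
      using orthonormal_frame_in_frames[OF orth span_superset] by simp
    show "gram_schmidt b $ i = (\<Sum>j\<in>UNIV. A $ i $ j *\<^sub>R b $ j)" for i
      by (simp add: A(2) lincomb_def)
  qed
qed

lemma continuous_on_vector_4: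
  fixes f g h k :: "'a::topological_space \<Rightarrow> 'b::real_normed_vector"
  assumes "continuous_on S f" "continuous_on S g" "continuous_on S h" "continuous_on S k"
  shows "continuous_on S (\<lambda>x. vector [f x, g x, h x, k x] :: 'b ^ 4)"
proof -
  have "vector [f x, g x, h x, k x]
      = (\<chi> i. if i = 1 then f x else if i = 2 then g x else if i = 3 then h x else k x :: 'b ^ 4)" for x
    by (simp add: vec_eq_iff forall_4)
  moreover have "continuous_on S (\<lambda>x. if i = 1 then f x else if i = 2 then g x else if i = 3 then h x else k x)" for i :: 4
    using assms by (cases "i = 1"; cases "i = 2"; cases "i = 3") simp_all
  ultimately show ?thesis
    by (simp only: continuous_on_vec_lambda)
qed

lemma continuous_on_vec_nth: 
  fixes f :: "'a::topological_space \<Rightarrow> 'b::real_normed_vector ^ 'n"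
  assumes "continuous_on S f"
  shows "continuous_on S (\<lambda>x. f x $ i)"
  using assms unfolding continuous_on_def by (blast intro: tendsto_vec_nth)

lemma continuous_on_gram_schmidt:
  "continuous_on (frames E) (gram_schmidt :: 'a::real_inner ^ 4 \<Rightarrow> 'a ^ 4)"
proof -
  let ?F = "frames E :: ('a ^ 4) set"
  define e1 where "e1 b = sgn (b $ 1)" for b :: "'a ^ 4"
  define g2 where "g2 b = b $ 2 - (b $ 2 \<bullet> e1 b) *\<^sub>R e1 b" for b :: "'a ^ 4"
  define e2 where "e2 b = sgn (g2 b)" for b
  define g3 where "g3 b = b $ 3 - (b $ 3 \<bullet> e1 b) *\<^sub>R e1 b - (b $ 3 \<bullet> e2 b) *\<^sub>R e2 b" for b
  define e3 where "e3 b = sgn (g3 b)" for b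
  define g4 where "g4 b = b $ 4 - (b $ 4 \<bullet> e1 b) *\<^sub>R e1 b - (b $ 4 \<bullet> e2 b) *\<^sub>R e2 b - (b $ 4 \<bullet> e3 b) *\<^sub>R e3 b" for b
  define e4 where "e4 b = sgn (g4 b)" for b
  have gs: "gram_schmidt b = vector [e1 b, e2 b, e3 b, e4 b]" for b
    by (simp add: gram_schmidt_def e1_def e2_def e3_def e4_def g2_def g3_def g4_def Let_def)
  \<comment> \<open>Read off from the unit length of the resulting vectors: \<open>sgn 0\<close>
    would have length zero.\<close>
  have nz: "b $ 1 \<noteq> 0" "g2 b \<noteq> 0" "g3 b \<noteq> 0" "g4 b \<noteq> 0" if "b \<in> ?F" for b
  proof -
    have "orthonormal_frame (gram_schmidt b)" using that by (rule orthonormal_gram_schmidt)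
    then have "\<forall>i. gram_schmidt b $ i \<bullet> gram_schmidt b $ i = 1" by (simp add: orthonormal_frame_def)
    then show "b $ 1 \<noteq> 0" "g2 b \<noteq> 0" "g3 b \<noteq> 0" "g4 b \<noteq> 0"
      unfolding gs forall_4 by (auto simp: e1_def e2_def e3_def e4_def)
  qed
  have b: "continuous_on ?F (\<lambda>b. b $ i)" for i
    by (intro continuous_on_vec_nth continuous_on_id)
  have 1: "continuous_on ?F e1"
    unfolding e1_def by (intro continuous_on_sgn b ballI nz)
  have 2: "continuous_on ?F e2"
    unfolding e2_def g2_def
    by (intro continuous_on_sgn continuous_on_diff continuous_on_scaleR continuous_on_inner b 1 ballI nz[unfolded g2_def])
  have 3: "continuous_on ?F e3"
    unfolding e3_def g3_def
    by (intro continuous_on_sgn continuous_on_diff continuous_on_scaleR continuous_on_inner b 1 2 ballI nz[unfolded g3_def])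
  have 4: "continuous_on ?F e4"
    unfolding e4_def g4_def
    by (intro continuous_on_sgn continuous_on_diff continuous_on_scaleR continuous_on_inner b 1 2 3 ballI nz[unfolded g4_def])
  show ?thesis
    unfolding gs by (intro continuous_on_vector_4 1 2 3 4)
qed

section \<open>The family of bodies\<close>

text \<open>For an orthonormal frame \<open>e\<close>, these are the coordinates with respect to
  \<open>e\<close> of the orthogonal projection of the \<open>i\<close>-th standard basis
  vector.\<close>

definition cols :: "finseq ^ 4 \<Rightarrow> nat \<Rightarrow> real ^ 4" where
  "cols e i = (\<chi> k. coord (e $ k) i)"

lemma coord_sum: "coord (\<Sum>i\<in>I. f i) n = (\<Sum>i\<in>I. coord (f i) n)"
  by (induction I rule: infinite_finite_induct) simp_all

lemma abs_coord_le: "\<bar>coord x n\<bar> \<le> norm x"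
proof (cases "coord x n = 0")
  case True
  then show ?thesis by simp
next
  case False
  have "(coord x n)\<^sup>2 \<le> (\<Sum>i | coord x i \<noteq> 0. coord x i * coord x i)"
    unfolding power2_eq_square
    by (rule member_le_sum) (use False finite_coord in auto)
  then have "(coord x n)\<^sup>2 \<le> (norm x)\<^sup>2"
    by (simp add: power2_norm_eq_inner inner_finseq_def)
  then show ?thesis using abs_le_square_iff[of "coord x n" "norm x"] by simp
qed

lemma bounded_linear_coord: "bounded_linear (\<lambda>x. coord x n)"
  by (rule bounded_linear_intro[where K = 1]) (simp_all add: abs_coord_le)

lemma continuous_on_cols:
  assumes "continuous_on S f"
  shows "continuous_on S (\<lambda>z. cols (f z) i)"
  unfolding cols_def
  by (intro continuous_on_vec_lambda bounded_linear.continuous_on[OF bounded_linear_coord]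
      continuous_on_vec_nth assms)

lemma continuous_on_lincomb:
  fixes f :: "'b::topological_space \<Rightarrow> 'a::real_normed_vector ^ 'n"
  assumes "continuous_on S f" "continuous_on S g"
  shows "continuous_on S (\<lambda>z. lincomb (f z) (g z))"
  unfolding lincomb_def
  by (intro continuous_on_sum continuous_on_scaleR continuous_on_component continuous_on_vec_nth assms)

text \<open>If all these minors vanished, the first two frame vectors would satisfy Cauchy-Schwarz
  with equality, giving 1 = 0.\<close>

lemma spanning_cols:
  assumes e: "orthonormal_frame e" and N: "\<And>k. e $ k \<in> Rn N"
  shows "spanning N (cols e)"
proof (rule ccontr)
  assume "\<not> spanning N (cols e)"
  then have *: "coord (e $ 1) i * coord (e $ 2) j = coord (e $ 2) i * coord (e $ 1) j" if "i < N" "j < N" for i j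
    using that by (auto simp: spanning_def cols_def)
  have "(e $ 1 \<bullet> e $ 1) * (e $ 2 \<bullet> e $ 2)
      = (\<Sum>i<N. \<Sum>j<N. (coord (e $ 1) i * coord (e $ 2) j) * (coord (e $ 1) i * coord (e $ 2) j))"
    unfolding inner_Rn[OF N] sum_product by (simp add: mult_ac)
  also have "\<dots> = (\<Sum>i<N. \<Sum>j<N. (coord (e $ 1) i * coord (e $ 2) j) * (coord (e $ 2) i * coord (e $ 1) j))"
    by (intro sum.cong refl arg_cong2[of _ _ _ _ "(*)"] *) auto
  also have "\<dots> = (e $ 1 \<bullet> e $ 2) * (e $ 1 \<bullet> e $ 2)"
    unfolding inner_Rn[OF N] sum_product by (simp add: mult_ac)
  finally show False using e by (simp add: orthonormal_frame_def)
qed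

definition root4 :: "real \<Rightarrow> real" where
  "root4 x = sqrt (sqrt x)"

lemma root4_pow: "0 \<le> x \<Longrightarrow> root4 x ^ 4 = x"
proof -
  assume x: "0 \<le> x"
  have "root4 x ^ 4 = ((sqrt (sqrt x))\<^sup>2)\<^sup>2" by (simp add: root4_def)
  also have "\<dots> = x" using x by simp
  finally show ?thesis .
qed

lemma root4_pos: "0 < x \<Longrightarrow> 0 < root4 x"
  by (simp add: root4_def)

lemma pow4_le_one_iff: "0 \<le> (x::real) \<Longrightarrow> x ^ 4 \<le> 1 \<longleftrightarrow> x \<le> 1"
  by (simp add: power_le_one_iff)

text \<open>The sublevel set \<open>form \<le> 1\<close>, written as the image of a compact set that does not depend on
  the frame, so that joint continuity gives Hausdorff continuity.\<close>

definition polar_param :: "nat \<Rightarrow> (finseq ^ 4) \<times> (real \<times> (real ^ 4)) \<Rightarrow> finseq" where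
  "polar_param N = (\<lambda>(e, r, x). (r / root4 (form N (cols e) x)) *\<^sub>R lincomb e x)"

definition body :: "nat \<Rightarrow> finseq ^ 4 \<Rightarrow> finseq set" where
  "body N e = (\<lambda>z. polar_param N (e, z)) ` ({0..1} \<times> sphere 0 1)"

text \<open>By homogeneity of degree four, the point with parameter \<open>r\<close> on the ray
  through a unit vector has form value \<open>r ^ 4\<close>.\<close>

lemma body_eq:
  assumes "spanning N (cols e)"
  shows "body N e = lincomb e ` {x. form N (cols e) x \<le> 1}"
proof -
  interpret L: linear "lincomb e" by (rule linear_lincomb)
  let ?f = "form N (cols e)"
  have pos: "0 < ?f x" if "x \<noteq> 0" for x by (rule form_pos[OF assms that])
  show ?thesis
  proof (intro equalityI subsetI)
    fix y assume "y \<in> body N e"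
    then obtain r x where rx: "0 \<le> r" "r \<le> 1" "norm x = 1" and y: "y = (r / root4 (?f x)) *\<^sub>R lincomb e x"
      by (auto simp: body_def polar_param_def)
    have "x \<noteq> 0" using rx by auto
    have "?f ((r / root4 (?f x)) *\<^sub>R x) = r ^ 4"
      unfolding form_scaleR power_divide using pos[OF \<open>x \<noteq> 0\<close>] by (simp add: root4_pow)
    also have "\<dots> \<le> 1" using rx by (simp add: pow4_le_one_iff)
    finally show "y \<in> lincomb e ` {x. ?f x \<le> 1}"
      unfolding y by (intro image_eqI[of _ _ "(r / root4 (?f x)) *\<^sub>R x"]) (simp_all add: L.scale)
  next
    fix y assume "y \<in> lincomb e ` {x. ?f x \<le> 1}"
    then obtain x where x: "?f x \<le> 1" and y: "y = lincomb e x" by blast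
    show "y \<in> body N e"
    proof (cases "x = 0")
      case True
      \<comment> \<open>At radius zero the direction is arbitrary; the first axis is taken.\<close>
      have "y = polar_param N (e, 0, axis 1 1)" by (simp add: polar_param_def y True L.zero)
      then show ?thesis unfolding body_def by (intro image_eqI[of _ _ "(0, axis 1 1)"]) auto
    next
      case False
      define s where "s = x /\<^sub>R norm x"
      have s: "norm s = 1" "s \<noteq> 0" "x = norm x *\<^sub>R s" using False by (simp_all add: s_def)
      define r where "r = norm x * root4 (?f s)"
      have p: "0 < root4 (?f s)" by (intro root4_pos pos s)
      have "r ^ 4 = ?f x"
        unfolding r_def power_mult_distrib using s(3) form_scaleR[of N "cols e" "norm x" s] pos[OF s(2)]
        by (simp add: root4_pow)
      then have "r \<le> 1" using x p pow4_le_one_iff[of r] by (simp add: r_def)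
      moreover have "0 \<le> r" using p by (simp add: r_def)
      moreover have "y = polar_param N (e, r, s)"
        using p s(3) by (simp add: polar_param_def r_def y L.scale[symmetric])
      ultimately show ?thesis
        unfolding body_def using s(1) by (intro image_eqI[of _ _ "(r, s)"]) auto
    qed
  qed
qed

lemma continuous_on_polar_param:
  assumes "\<And>e. e \<in> F \<Longrightarrow> spanning N (cols e)"
  shows "continuous_on (F \<times> ({0..1} \<times> sphere 0 1)) (polar_param N)"
proof -
  let ?S = "F \<times> ({0..1::real} \<times> sphere (0::real ^ 4) 1)"
  have 1: "continuous_on ?S (\<lambda>z. form N (cols (fst z)) (snd (snd z)))"
    by (rule continuous_on_form) (auto intro!: continuous_on_cols continuous_intros assms)
  have "root4 (form N (cols (fst z)) (snd (snd z))) \<noteq> 0" if "z \<in> ?S" for z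
  proof -
    have "0 < form N (cols (fst z)) (snd (snd z))"
      using that by (intro form_pos assms) auto
    then show ?thesis using root4_pos by fastforce
  qed
  then have "continuous_on ?S (\<lambda>z. (fst (snd z) / root4 (form N (cols (fst z)) (snd (snd z)))) *\<^sub>R lincomb (fst z) (snd (snd z)))"
    unfolding root4_def
    by (intro continuous_on_scaleR continuous_on_divide continuous_on_lincomb continuous_on_real_sqrt 1
        continuous_on_fst continuous_on_snd continuous_on_id ballI) auto
  then show ?thesis by (simp add: polar_param_def case_prod_beta')
qed

lemma compact_param: "compact ({0..1::real} \<times> sphere (0::real ^ 4) 1)"
  by (intro compact_Times compact_Icc compact_sphere)

lemma compact_body:
  assumes "spanning N (cols e)"
  shows "compact (body N e)"
proof -
  have "continuous_on ({0..1} \<times> sphere 0 1) (\<lambda>z. polar_param N (e, z))"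
    by (rule continuous_on_compose2[OF continuous_on_polar_param[of "{e}" N]])
      (use assms in \<open>auto intro!: continuous_intros\<close>)
  then show ?thesis unfolding body_def by (intro compact_continuous_image compact_param)
qed

section \<open>Continuity in the Hausdorff metric\<close>

lemma hausdorff_dist_image_le:
  fixes f g :: "'b \<Rightarrow> 'a::metric_space"
  assumes "bounded (f ` C)" "bounded (g ` C)" "C \<noteq> {}" "\<And>c. c \<in> C \<Longrightarrow> dist (f c) (g c) \<le> \<epsilon>"
  shows "hausdorff_dist (f ` C) (g ` C) \<le> \<epsilon>"
proof -
  have "(SUP a\<in>f ` C. infdist a (g ` C)) \<le> \<epsilon>"
    using assms(3) by (intro cSUP_least) (auto intro: infdist_le2 assms(4))
  moreover have "(SUP b\<in>g ` C. infdist b (f ` C)) \<le> \<epsilon>"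
    using assms(3) by (intro cSUP_least) (auto intro: infdist_le2 simp: dist_commute assms(4))
  ultimately show ?thesis
    using assms by (simp add: hausdorff_dist_def)
qed

text \<open>Compactness of \<open>C\<close> makes the maps at nearby parameters uniformly close, and
  this bounds the Hausdorff distance of their images.\<close>

lemma continuous_map_hausdorff_image:
  fixes \<Phi> :: "'a::topological_space \<times> 'b::topological_space \<Rightarrow> 'c::metric_space"
  assumes cont: "continuous_on (F \<times> C) \<Phi>" and C: "compact C" "C \<noteq> {}"
  shows "continuous_map (top_of_set F) hausdorff_topology (\<lambda>x. (\<lambda>c. \<Phi> (x, c)) ` C)"
proof -
  interpret Metric_space "{K :: 'c set. compact K \<and> K \<noteq> {}}" hausdorff_dist
    by (rule Metric_space_hausdorff_dist)
  have cpt: "compact ((\<lambda>c. \<Phi> (x, c)) ` C)" if "x \<in> F" for x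
  proof (rule compact_continuous_image[OF _ C(1)])
    show "continuous_on C (\<lambda>c. \<Phi> (x, c))"
      by (rule continuous_on_compose2[OF cont]) (use that in \<open>auto intro!: continuous_intros\<close>)
  qed
  show ?thesis
    unfolding hausdorff_topology_def continuous_map_to_metric
  proof (intro ballI allI impI)
    fix x and \<epsilon> :: real assume x: "x \<in> topspace (top_of_set F)" and \<epsilon>: "0 < \<epsilon>"
    then have "x \<in> F" "0 < \<epsilon> / 2" by auto
    \<comment> \<open>Half of \<open>\<epsilon>\<close>, because the uniform bound is not strict and
      the metric ball is open.\<close>
    from continuous_on_prod_compactE[OF cont C(1) this] obtain X0 where X0: "x \<in> X0" "open X0"
      "\<forall>y\<in>X0 \<inter> F. \<forall>t\<in>C. dist (\<Phi> (y, t)) (\<Phi> (x, t)) \<le> \<epsilon> / 2" by blast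
    show "\<exists>U. openin (top_of_set F) U \<and> x \<in> U \<and>
        (\<forall>y\<in>U. (\<lambda>c. \<Phi> (y, c)) ` C \<in> mball ((\<lambda>c. \<Phi> (x, c)) ` C) \<epsilon>)"
    proof (intro exI conjI ballI)
      show "openin (top_of_set F) (F \<inter> X0)" using X0(2) by (rule openin_open_Int)
      show "x \<in> F \<inter> X0" using X0(1) \<open>x \<in> F\<close> by blast
      fix y assume y: "y \<in> F \<inter> X0"
      have "hausdorff_dist ((\<lambda>c. \<Phi> (x, c)) ` C) ((\<lambda>c. \<Phi> (y, c)) ` C) \<le> \<epsilon> / 2"
      proof (rule hausdorff_dist_image_le)
        show "dist (\<Phi> (x, c)) (\<Phi> (y, c)) \<le> \<epsilon> / 2" if "c \<in> C" for c
          using X0(3) y that by (subst dist_commute) blast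
      qed (use y \<open>x \<in> F\<close> C(2) cpt in \<open>auto intro: compact_imp_bounded\<close>)
      also have "\<dots> < \<epsilon>" using \<epsilon> by simp
      finally show "(\<lambda>c. \<Phi> (y, c)) ` C \<in> mball ((\<lambda>c. \<Phi> (x, c)) ` C) \<epsilon>"
        using cpt y \<open>x \<in> F\<close> C(2) by (simp add: mball_def)
    qed
  qed
qed

section \<open>Independence of the frame\<close>

lemma lincomb_rotate:
  fixes R :: "real ^ 'n ^ 'n"
  assumes "\<And>i. e' $ i = lincomb e (R $ i)"
  shows "lincomb e' x = lincomb e (transpose R *v x)"
proof -
  have "lincomb e' x = (\<Sum>i\<in>UNIV. \<Sum>j\<in>UNIV. (x $ i * R $ i $ j) *\<^sub>R e $ j)"
    unfolding lincomb_def[of e'] assms unfolding lincomb_def by (simp add: scaleR_sum_right)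
  also have "\<dots> = (\<Sum>j\<in>UNIV. \<Sum>i\<in>UNIV. (x $ i * R $ i $ j) *\<^sub>R e $ j)"
    by (rule sum.swap)
  also have "\<dots> = lincomb e (transpose R *v x)"
    by (simp only: lincomb_def matrix_vector_mult_def transpose_def vec_lambda_beta scaleR_sum_left mult.commute)
  finally show ?thesis .
qed

text \<open>The change of basis is an orthogonal matrix of positive determinant, hence a rotation
  \<open>R\<close>. Passing to \<open>e'\<close> applies \<open>R\<close> to the columns and to the
  coordinates alike, so \<open>form_rotation\<close> identifies the two sublevel sets.\<close>

lemma body_same_orientation:
  assumes ee': "(e, e') \<in> same_orientation V" and o: "orthonormal_frame e" "orthonormal_frame e'"
    and span: "spanning N (cols e)" "spanning N (cols e')"
  shows "body N e' = body N e"
proof -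
  obtain R :: "real ^ 4 ^ 4" where R: "det R > 0" "\<And>i. e' $ i = (\<Sum>j\<in>UNIV. R $ i $ j *\<^sub>R e $ j)"
    using ee' by (auto simp: same_orientation_def)
  then have R': "e' $ i = lincomb e (R $ i)" for i by (simp add: lincomb_def)
  have "(R ** transpose R) $ i $ j = mat 1 $ i $ j" for i j
  proof -
    have "(R ** transpose R) $ i $ j = R $ i \<bullet> R $ j"
      by (simp add: matrix_matrix_mult_def transpose_def inner_vec_def)
    also have "\<dots> = e' $ i \<bullet> e' $ j" unfolding R' inner_lincomb[OF o(1)] ..
    finally show ?thesis using o(2) by (simp add: orthonormal_frame_def mat_def)
  qed
  then have RR: "R ** transpose R = mat 1" by (simp add: vec_eq_iff)
  then have orth: "orthogonal_matrix R" and RR': "transpose R ** R = mat 1"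
    using matrix_left_right_inverse by (auto simp: orthogonal_matrix_def)
  then have rot: "rotation_matrix R"
    using R(1) det_orthogonal_matrix[OF orth] by (auto simp: rotation_matrix_def)
  have cols: "cols e' = (\<lambda>i. R *v cols e i)"
    by (simp add: fun_eq_iff cols_def R(2) coord_sum vec_eq_iff matrix_vector_mult_def)
  have "lincomb e' (R *v x) = lincomb e x" for x
    unfolding lincomb_rotate[OF R'] by (simp only: matrix_vector_mul_assoc RR' matrix_vector_mul_lid)
  then have img: "lincomb e ` A = lincomb e' ` ((*v) R ` A)" for A
    by (simp add: image_image)
  have "(*v) R ` {x. form N (cols e) x \<le> 1} = {x. form N (cols e') x \<le> 1}"
  proof (intro equalityI subsetI)
    fix y assume "y \<in> {x. form N (cols e') x \<le> 1}"
    moreover have y: "y = R *v (transpose R *v y)"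
      by (simp only: matrix_vector_mul_assoc RR matrix_vector_mul_lid)
    ultimately have "form N (cols e) (transpose R *v y) \<le> 1"
      unfolding cols using form_rotation[OF rot, of N "cols e" "transpose R *v y"] by simp
    then show "y \<in> (*v) R ` {x. form N (cols e) x \<le> 1}" using y by blast
  qed (auto simp: cols form_rotation[OF rot])
  then show ?thesis
    unfolding body_eq[OF span(1)] body_eq[OF span(2)] img by simp
qed

section \<open>Convexity, symmetry and the distance to balls\<close>

lemma bounded_scale_subset:
  fixes B D V :: "'a::real_normed_vector set"
  assumes "subspace V" "B \<subseteq> V" "bounded B" "0 < \<rho>" "V \<inter> cball 0 \<rho> \<subseteq> D"
  obtains s where "0 < s" "(*\<^sub>R) s ` B \<subseteq> D"
proof -
  obtain M where M: "0 < M" "\<And>b. b \<in> B \<Longrightarrow> norm b \<le> M"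
    using assms(3) by (meson bounded_pos)
  show ?thesis
  proof
    show "0 < \<rho> / M" using M assms(4) by simp
    show "(*\<^sub>R) (\<rho> / M) ` B \<subseteq> D"
    proof (rule image_subsetI)
      fix b assume b: "b \<in> B"
      have "norm ((\<rho> / M) *\<^sub>R b) = (\<rho> / M) * norm b"
        using M(1) assms(4) by simp
      also have "\<dots> \<le> (\<rho> / M) * M"
        using M b assms(4) by (intro mult_left_mono) auto
      also have "\<dots> = \<rho>" using M by simp
      finally have "(\<rho> / M) *\<^sub>R b \<in> cball 0 \<rho>" by simp
      moreover have "(\<rho> / M) *\<^sub>R b \<in> V" using assms(1,2) b by (auto intro: subspace_scale)
      ultimately show "(\<rho> / M) *\<^sub>R b \<in> D" using assms(5) by blast
    qed
  qed
qed

lemma body_contains_ball: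
  assumes "orthonormal_frame e" "spanning N (cols e)"
  obtains \<rho> where "0 < \<rho>" "span (range (\<lambda>i. e $ i)) \<inter> cball 0 \<rho> \<subseteq> body N e"
proof -
  have "continuous_on UNIV (form N (cols e))"
    by (rule continuous_on_form) (auto intro: continuous_intros assms)
  then have "open {x. form N (cols e) x < 1}"
    by (intro open_Collect_less continuous_on_const)
  moreover have "0 \<in> {x. form N (cols e) x < 1}"
    using form_scaleR[of N "cols e" 0 0] by simp
  ultimately obtain \<rho> where \<rho>: "0 < \<rho>" "cball 0 \<rho> \<subseteq> {x. form N (cols e) x < 1}"
    using open_contains_cball by (metis (no_types))
  show ?thesis
  proof (rule that[OF \<rho>(1)], rule subsetI)
    fix z assume z: "z \<in> span (range (\<lambda>i. e $ i)) \<inter> cball 0 \<rho>"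
    then obtain x where x: "z = lincomb e x" unfolding range_lincomb[symmetric] by blast
    then have "x \<in> cball 0 \<rho>" using z norm_lincomb[OF assms(1), of x] by simp
    then have "form N (cols e) x < 1" using \<rho>(2) by blast
    then have "form N (cols e) x \<le> 1" by simp
    then show "z \<in> body N e" unfolding body_eq[OF assms(2)] x by blast
  qed
qed

lemma convex_body:
  assumes "spanning N (cols e)"
  shows "convex (body N e)"
proof -
  have "convex {x. form N (cols e) x \<le> 1}"
  proof (rule convexI)
    fix x y and u v :: real
    assume xy: "x \<in> {x. form N (cols e) x \<le> 1}" "y \<in> {x. form N (cols e) x \<le> 1}"
      and uv: "0 \<le> u" "0 \<le> v" "u + v = 1"
    have "form N (cols e) (u *\<^sub>R x + v *\<^sub>R y) \<le> u * form N (cols e) x + v * form N (cols e) y"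
      using convex_on_form[of N "cols e"] uv by (simp add: convex_on_def)
    also have "\<dots> \<le> 1"
      using xy uv by (intro convex_bound_le) auto
    finally show "u *\<^sub>R x + v *\<^sub>R y \<in> {x. form N (cols e) x \<le> 1}" by simp
  qed
  then show ?thesis
    unfolding body_eq[OF assms] using convex_linear_image[OF linear_lincomb] by simp
qed

lemma uminus_mem_body:
  assumes "spanning N (cols e)" "z \<in> body N e"
  shows "- z \<in> body N e"
proof -
  obtain x where x: "z = lincomb e x" "form N (cols e) x \<le> 1"
    using assms(2) unfolding body_eq[OF assms(1)] by blast
  have "- z = lincomb e ((-1) *\<^sub>R x)"
    unfolding x using linear_scale[OF linear_lincomb, of e "-1" x] by simp
  moreover have "form N (cols e) ((-1) *\<^sub>R x) \<le> 1" unfolding form_scaleR using x by simp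
  ultimately show ?thesis unfolding body_eq[OF assms(1)] by blast
qed

lemma body_subset_span:
  assumes "spanning N (cols e)"
  shows "body N e \<subseteq> span (range (\<lambda>i. e $ i))"
  unfolding body_eq[OF assms] range_lincomb[symmetric] by blast

lemma convex_body_in_body:
  assumes "orthonormal_frame e" "spanning N (cols e)"
  shows "convex_body_in (span (range (\<lambda>i. e $ i))) (body N e)"
proof -
  let ?V = "span (range (\<lambda>i. e $ i))"
  obtain \<rho> where \<rho>: "0 < \<rho>" "?V \<inter> cball 0 \<rho> \<subseteq> body N e"
    using body_contains_ball[OF assms] by blast
  have "openin (top_of_set ?V) (?V \<inter> ball 0 \<rho>)" by (intro openin_open_Int open_ball)
  moreover have "?V \<inter> ball 0 \<rho> \<subseteq> body N e" using \<rho>(2) ball_subset_cball by blast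
  ultimately have "?V \<inter> ball 0 \<rho> \<subseteq> (top_of_set ?V) interior_of body N e"
    by (rule interior_of_maximal[rotated])
  moreover have "0 \<in> ?V \<inter> ball 0 \<rho>" using \<rho>(1) by (simp add: span_zero)
  ultimately show ?thesis
    unfolding convex_body_in_def using body_subset_span compact_body convex_body assms(2) by blast
qed

lemma origin_symmetric_body:
  assumes "spanning N (cols e)"
  shows "origin_symmetric (body N e)"
  unfolding origin_symmetric_def
proof (intro equalityI subsetI)
  fix z assume "z \<in> body N e"
  then show "z \<in> uminus ` body N e"
    using uminus_mem_body[OF assms] by (intro image_eqI[of _ _ "- z"]) auto
qed (use uminus_mem_body[OF assms] in auto)

text \<open>Since the body is symmetric, an off-centre ball can be replaced by the centred one of the same
  radius: the inner inclusion forces \<open>s\<cdot>X\<close> and \<open>-s\<cdot>X\<close> into it, the outer one is averaged with its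
  reflection.\<close>

lemma ratio_le_homothety:
  assumes o: "orthonormal_frame e" and sp: "spanning N (cols e)"
    and xy: "norm x = 1" "norm y = 1"
    and st: "0 < s" "0 < t"
    and c: "c \<in> span (range (\<lambda>i. e $ i))" "0 < r"
    and D: "D = cball c r \<inter> span (range (\<lambda>i. e $ i))"
    and incl: "(*\<^sub>R) s ` body N e \<subseteq> D" "D \<subseteq> (*\<^sub>R) t ` body N e"
  shows "s ^ 4 * form N (cols e) y \<le> t ^ 4 * form N (cols e) x"
proof -
  interpret L: linear "lincomb e" by (rule linear_lincomb)
  let ?f = "form N (cols e)" and ?V = "span (range (\<lambda>i. e $ i))"
  have fpos: "0 < ?f x" "0 < ?f y" using xy by (auto intro!: form_pos[OF sp])
  \<comment> \<open>Scales \<open>x\<close> to the level set where the form equals 1.\<close>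
  define a where "a = inverse (root4 (?f x))"
  have a4: "a ^ 4 = inverse (?f x)" and a: "0 < a"
    using fpos root4_pow[of "?f x"] root4_pos[of "?f x"] by (simp_all add: a_def power_inverse)
  have "?f (a *\<^sub>R x) = 1" unfolding form_scaleR a4 using fpos by simp
  then have aX: "lincomb e (a *\<^sub>R x) \<in> body N e" unfolding body_eq[OF sp] by auto
  define p where "p = s *\<^sub>R lincomb e (a *\<^sub>R x)"
  have "p \<in> D" "- p \<in> D"
    using incl(1) aX uminus_mem_body[OF sp aX] unfolding p_def by (auto simp flip: scaleR_minus_right)
  then have "norm (c - p) \<le> r" "norm (c + p) \<le> r" by (auto simp: D dist_norm)
  \<comment> \<open>The centre cancels in the difference, leaving \<open>2 p\<close>.\<close>
  then have "norm ((c + p) - (c - p)) \<le> r + r"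
    using norm_triangle_ineq4[of "c + p" "c - p"] by linarith
  moreover have "(c + p) - (c - p) = 2 *\<^sub>R p" by (simp add: scaleR_2)
  moreover have "norm p = s * a"
    using st a xy by (simp add: p_def norm_lincomb[OF o])
  ultimately have sa: "s * a \<le> r" by simp
  have Y: "norm (lincomb e y) = 1" using xy by (simp add: norm_lincomb[OF o])
  have YV: "lincomb e y \<in> ?V" unfolding range_lincomb[symmetric] by blast
  have "c + r *\<^sub>R lincomb e y \<in> D" "c - r *\<^sub>R lincomb e y \<in> D"
    using c Y YV by (auto simp: D dist_norm intro!: span_add span_diff span_scale)
  then obtain u v where u: "u \<in> body N e" "c + r *\<^sub>R lincomb e y = t *\<^sub>R u"
      and v: "v \<in> body N e" "c - r *\<^sub>R lincomb e y = t *\<^sub>R v"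
    using incl(2) by blast
  have "(1/2) *\<^sub>R u + (1/2) *\<^sub>R (- v) \<in> body N e"
    using convexD[OF convex_body[OF sp] u(1) uminus_mem_body[OF sp v(1)], of "1/2" "1/2"] by simp
  moreover have "t *\<^sub>R ((1/2) *\<^sub>R u + (1/2) *\<^sub>R (- v)) = r *\<^sub>R lincomb e y"
  proof -
    have "t *\<^sub>R ((1/2) *\<^sub>R u + (1/2) *\<^sub>R (- v)) = (1/2) *\<^sub>R (t *\<^sub>R u) - (1/2) *\<^sub>R (t *\<^sub>R v)"
      by (simp add: scaleR_diff_right mult.commute)
    also have "\<dots> = r *\<^sub>R lincomb e y"
      unfolding u(2)[symmetric] v(2)[symmetric] by (simp add: algebra_simps flip: scaleR_2 scaleR_left_distrib)
    finally show ?thesis .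
  qed
  ultimately obtain z where z: "?f z \<le> 1" "t *\<^sub>R lincomb e z = r *\<^sub>R lincomb e y"
    unfolding body_eq[OF sp] by force
  have "lincomb e (t *\<^sub>R z - r *\<^sub>R y) = 0" using z(2) by (simp add: L.diff L.scale)
  then have "t *\<^sub>R z = r *\<^sub>R y" using norm_lincomb[OF o, of "t *\<^sub>R z - r *\<^sub>R y"] by simp
  then have "r ^ 4 * ?f y = t ^ 4 * ?f z" by (metis form_scaleR)
  also have "\<dots> \<le> t ^ 4" using z(1) by (simp add: mult_left_le)
  finally have ty: "r ^ 4 * ?f y \<le> t ^ 4" .
  have "(s * a) ^ 4 \<le> r ^ 4" using sa st a by (intro power_mono) auto
  then have "s ^ 4 \<le> r ^ 4 * ?f x" unfolding power_mult_distrib a4 using fpos by (simp add: field_simps)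
  then have "s ^ 4 * ?f y \<le> (r ^ 4 * ?f x) * ?f y" using fpos by (intro mult_right_mono) auto
  also have "\<dots> = (r ^ 4 * ?f y) * ?f x" by simp
  also have "\<dots> \<le> t ^ 4 * ?f x" using ty fpos by (intro mult_right_mono) auto
  finally show ?thesis .
qed

text \<open>The form has degree four, so a factor \<open>1 + \<eta>\<close> between two of its
  values on the sphere forces \<open>(t / s) ^ 4\<close> to be at least
  \<open>1 + \<eta>\<close>.\<close>

lemma homothety_dist_body_ge:
  assumes o: "orthonormal_frame e" and sp: "spanning N (cols e)" and "0 < \<eta>"
    and xy: "norm x = 1" "norm y = 1" "(1 + \<eta>) * form N (cols e) x < form N (cols e) y"
    and V: "V = span (range (\<lambda>i. e $ i))"
    and D: "euclidean_ball_in V D" "0 \<in> (top_of_set V) interior_of D"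
  shows "ln (1 + \<eta>) / 4 \<le> homothety_dist (body N e) D"
  unfolding homothety_dist_def
proof (rule cInf_greatest)
  obtain c r where c: "c \<in> V" "0 < r" and Deq: "D = cball c r \<inter> V"
    using D(1) by (auto simp: euclidean_ball_in_def)
  have subV: "subspace V" by (simp add: V)
  obtain \<rho> where \<rho>: "0 < \<rho>" "V \<inter> cball 0 \<rho> \<subseteq> D"
  proof -
    obtain T where T: "openin (top_of_set V) T" "0 \<in> T" "T \<subseteq> D"
      using D(2) by (auto simp: interior_of_def)
    then obtain \<rho> where "0 < \<rho>" "cball 0 \<rho> \<inter> V \<subseteq> T" unfolding openin_contains_cball by blast
    with T(3) show ?thesis by (intro that[of \<rho>]) auto
  qed
  obtain \<rho>' where \<rho>': "0 < \<rho>'" "V \<inter> cball 0 \<rho>' \<subseteq> body N e"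
    using body_contains_ball[OF o sp] unfolding V by blast
  \<comment> \<open>This \<open>s\<close>, with \<open>inverse t'\<close> for \<open>t\<close>,
    shows that the infimum is taken over a nonempty set.\<close>
  obtain s where s: "0 < s" "(*\<^sub>R) s ` body N e \<subseteq> D"
    by (rule bounded_scale_subset[OF subV _ _ \<rho>])
      (use body_subset_span[OF sp] compact_body[OF sp] in \<open>auto simp: V compact_imp_bounded\<close>)
  have "bounded D" unfolding Deq by (intro bounded_Int disjI1 bounded_cball)
  then obtain t' where t': "0 < t'" "(*\<^sub>R) t' ` D \<subseteq> body N e"
    using bounded_scale_subset[OF subV _ _ \<rho>', of D] Deq by blast
  have Dsub: "D \<subseteq> (*\<^sub>R) (inverse t') ` body N e"
  proof
    fix z assume "z \<in> D"
    then have "t' *\<^sub>R z \<in> body N e" using t'(2) by blast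
    then show "z \<in> (*\<^sub>R) (inverse t') ` body N e"
      using t'(1) by (intro image_eqI[of _ _ "t' *\<^sub>R z"]) auto
  qed
  have "0 < inverse t'" using t'(1) by simp
  with s Dsub show "{ln (t / s) |s t. 0 < s \<and> 0 < t \<and> (*\<^sub>R) s ` body N e \<subseteq> D \<and> D \<subseteq> (*\<^sub>R) t ` body N e} \<noteq> {}"
    by blast
  fix l assume "l \<in> {ln (t / s) |s t. 0 < s \<and> 0 < t \<and> (*\<^sub>R) s ` body N e \<subseteq> D \<and> D \<subseteq> (*\<^sub>R) t ` body N e}"
  then obtain s t where st: "0 < s" "0 < t" "(*\<^sub>R) s ` body N e \<subseteq> D" "D \<subseteq> (*\<^sub>R) t ` body N e"
    and l: "l = ln (t / s)" by blast
  have fx: "0 < form N (cols e) x" using xy by (auto intro!: form_pos[OF sp])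
  have "s ^ 4 * form N (cols e) y \<le> t ^ 4 * form N (cols e) x"
    by (rule ratio_le_homothety[OF o sp xy(1,2) st(1,2) _ c(2) _ st(3,4)]) (use c Deq V in auto)
  moreover have "s ^ 4 * ((1 + \<eta>) * form N (cols e) x) \<le> s ^ 4 * form N (cols e) y"
    using xy(3) st(1) by (intro mult_left_mono) auto
  ultimately have "(s ^ 4 * (1 + \<eta>)) * form N (cols e) x \<le> t ^ 4 * form N (cols e) x"
    by (simp add: mult.assoc)
  then have "s ^ 4 * (1 + \<eta>) \<le> t ^ 4" using fx by simp
  then have "1 + \<eta> \<le> (t / s) ^ 4" using st(1) by (simp add: power_divide field_simps)
  then have "ln (1 + \<eta>) \<le> ln ((t / s) ^ 4)" using \<open>0 < \<eta>\<close> st by simp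
  also have "\<dots> = 4 * ln (t / s)" using st by (simp add: ln_realpow)
  finally show "ln (1 + \<eta>) / 4 \<le> l" by (simp add: l)
qed

section \<open>Assembly over the oriented Grassmannian\<close>

lemma subspace_Rn: "subspace (Rn N)"
  by (simp add: subspace_def Rn_def)

lemma frames_gram_schmidt:
  assumes b: "b \<in> frames (Rn N)"
  shows "orthonormal_frame (gram_schmidt b)" "spanning N (cols (gram_schmidt b))"
    "span (range (\<lambda>i. gram_schmidt b $ i)) = span (range (\<lambda>i. b $ i))"
proof -
  show o: "orthonormal_frame (gram_schmidt b)" by (rule orthonormal_gram_schmidt[OF b])
  have "gram_schmidt b \<in> ordered_bases (span (range (\<lambda>i. b $ i)))"
    using gram_schmidt_same_orientation[OF b refl] by (simp add: same_orientation_def)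
  then show eq: "span (range (\<lambda>i. gram_schmidt b $ i)) = span (range (\<lambda>i. b $ i))"
    by (simp add: ordered_bases_def)
  have "span (range (\<lambda>i. b $ i)) \<subseteq> Rn N"
    using b by (intro span_minimal subspace_Rn) (simp add: frames_def)
  then have "gram_schmidt b $ k \<in> Rn N" for k
    unfolding eq[symmetric] using span_base[of "gram_schmidt b $ k" "range (\<lambda>i. gram_schmidt b $ i)"] by blast
  then show "spanning N (cols (gram_schmidt b))" by (rule spanning_cols[OF o])
qed

text \<open>Frames with equal oriented span have orthonormalisations of the same orientation, to
  which \<open>body_same_orientation\<close> applies.\<close>

lemma body_gram_schmidt_cong:
  assumes b: "b \<in> frames (Rn N)" "b' \<in> frames (Rn N)" and eq: "oriented_span b' = oriented_span b"
  shows "body N (gram_schmidt b') = body N (gram_schmidt b)"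
proof -
  define V where "V = span (range (\<lambda>i. b $ i))"
  have V': "V = span (range (\<lambda>i. b' $ i))"
    and cls: "same_orientation V `` {b'} = same_orientation V `` {b}"
    using eq by (auto simp: oriented_span_def Let_def V_def)
  have equiv: "equiv (ordered_bases V) (same_orientation V :: (finseq ^ 4) rel)"
    by (rule equiv_same_orientation)
  note 1 = gram_schmidt_same_orientation[OF b(1) V_def] and 2 = gram_schmidt_same_orientation[OF b(2) V']
  have "b \<in> ordered_bases V" using 1 by (simp add: same_orientation_def)
  then have "(b', b) \<in> same_orientation V"
    using cls equiv_class_self[OF equiv] by blast
  then have "(gram_schmidt b, gram_schmidt b') \<in> same_orientation V"
    using 1 2 equiv by (meson equivE symE transE)
  then show ?thesis
    by (rule body_same_orientation) (use frames_gram_schmidt b in blast)+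
qed

theorem theorem3:
  shows "\<exists>\<delta>::real. \<delta> > 0 \<and> (\<forall>N::nat. N \<ge> 4 \<longrightarrow>
    (\<exists>B :: finseq set \<times> (finseq ^ 4) set \<Rightarrow> finseq set.
       continuous_map (oriented_grassmannian_topology (Rn N)) hausdorff_topology B \<and>
       (\<forall>(V, \<omega>) \<in> oriented_grassmannian (Rn N).
          convex_body_in V (B (V, \<omega>)) \<and> origin_symmetric (B (V, \<omega>)) \<and>
          (\<forall>D. euclidean_ball_in V D \<and> 0 \<in> (top_of_set V) interior_of D \<longrightarrow>
             homothety_dist (B (V, \<omega>)) D > \<delta>))))"
proof -
  \<comment> \<open>Obtained before the ambient dimension is fixed.\<close>
  obtain \<eta> where \<eta>: "0 < \<eta>" "\<And>N M. N \<in> unit_traceless \<Longrightarrow> M \<in> unit_traceless \<Longrightarrow>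
    \<exists>x y. norm x = 1 \<and> norm y = 1 \<and>
      (1 + \<eta>) * quartic (sqmat N) (sqmat M) x < quartic (sqmat N) (sqmat M) y"
    by (rule quartic_uniform_ratio) blast
  show ?thesis
  \<comment> \<open>Half of the lower bound in \<open>homothety_dist_body_ge\<close>, to make the
    inequality strict.\<close>
  proof (intro exI[of _ "ln (1 + \<eta>) / 8"] conjI allI impI)
    show "0 < ln (1 + \<eta>) / 8" using \<eta>(1) by simp
    fix N :: nat
    let ?F = "frames (Rn N) :: (finseq ^ 4) set"
    \<comment> \<open>The chosen frame is immaterial by
      \<open>body_gram_schmidt_cong\<close>.\<close>
    define B where "B p = body N (gram_schmidt (SOME b. b \<in> ?F \<and> oriented_span b = p))" for p
    have B: "B (oriented_span b) = body N (gram_schmidt b)" if "b \<in> ?F" for b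
    proof -
      have "\<exists>b'. b' \<in> ?F \<and> oriented_span b' = oriented_span b" using that by blast
      from someI_ex[OF this] show ?thesis
        unfolding B_def using body_gram_schmidt_cong[OF that] by blast
    qed
    \<comment> \<open>Continuity is shown on frames, where the body is the image of a fixed compact
      set under a jointly continuous map. It descends to the Grassmannian along the quotient
      map.\<close>
    have "continuous_on (?F \<times> ({0..1} \<times> sphere 0 1)) (\<lambda>z. polar_param N (gram_schmidt (fst z), snd z))"
    proof (rule continuous_on_compose2[OF continuous_on_polar_param[of "gram_schmidt ` ?F" N]])
      show "continuous_on (?F \<times> ({0..1} \<times> sphere 0 1)) (\<lambda>z. (gram_schmidt (fst z), snd z))"
        by (intro continuous_on_Pair continuous_on_compose2[OF continuous_on_gram_schmidt]
            continuous_on_fst continuous_on_snd continuous_on_id) auto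
    qed (use frames_gram_schmidt in auto)
    from continuous_map_hausdorff_image[OF this compact_param]
    have "continuous_map (top_of_set ?F) hausdorff_topology (\<lambda>b. body N (gram_schmidt b))"
      unfolding body_def by force
    then have "continuous_map (top_of_set ?F) hausdorff_topology (B \<circ> oriented_span)"
      by (rule continuous_map_eq) (simp add: B)
    then have cont: "continuous_map (oriented_grassmannian_topology (Rn N)) hausdorff_topology B"
      using continuous_compose_quotient_map_eq[OF quotient_map_oriented_span[OF subspace_Rn]] by blast
    have main: "convex_body_in V (B (V, \<omega>)) \<and> origin_symmetric (B (V, \<omega>)) \<and>
          (\<forall>D. euclidean_ball_in V D \<and> 0 \<in> (top_of_set V) interior_of D \<longrightarrow>
             homothety_dist (B (V, \<omega>)) D > ln (1 + \<eta>) / 8)"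
      if V\<omega>: "(V, \<omega>) \<in> oriented_grassmannian (Rn N)" for V and \<omega> :: "(finseq ^ 4) set"
    proof -
      obtain b where b: "b \<in> ?F" "(V, \<omega>) = oriented_span b"
        using V\<omega> unfolding oriented_span_image[OF subspace_Rn, symmetric] by blast
      define e where "e = gram_schmidt b"
      note e = frames_gram_schmidt[OF b(1), folded e_def]
      have V: "V = span (range (\<lambda>i. e $ i))"
        using b(2) e(3) by (simp add: oriented_span_def Let_def)
      have Bp: "B (V, \<omega>) = body N e" using B[OF b(1)] by (simp add: b(2) e_def)
      obtain x y where xy: "norm x = 1" "norm y = 1" "(1 + \<eta>) * form N (cols e) x < form N (cols e) y"
        using \<eta>(2)[OF spanning_imp_state[OF e(2)]] unfolding form_def by blast
      have "homothety_dist (body N e) D > ln (1 + \<eta>) / 8"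
        if "euclidean_ball_in V D" "0 \<in> (top_of_set V) interior_of D" for D
      proof -
        have "ln (1 + \<eta>) / 4 \<le> homothety_dist (body N e) D"
          by (rule homothety_dist_body_ge[OF e(1,2) \<eta>(1) xy V that])
        moreover have "0 < ln (1 + \<eta>)" using \<eta>(1) by simp
        ultimately show ?thesis by linarith
      qed
      then show ?thesis
        unfolding Bp using convex_body_in_body[OF e(1,2)] origin_symmetric_body[OF e(2)] V by blast
    qed
    show "\<exists>B :: finseq set \<times> (finseq ^ 4) set \<Rightarrow> finseq set.
       continuous_map (oriented_grassmannian_topology (Rn N)) hausdorff_topology B \<and>
       (\<forall>(V, \<omega>) \<in> oriented_grassmannian (Rn N).
          convex_body_in V (B (V, \<omega>)) \<and> origin_symmetric (B (V, \<omega>)) \<and>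
          (\<forall>D. euclidean_ball_in V D \<and> 0 \<in> (top_of_set V) interior_of D \<longrightarrow>
             homothety_dist (B (V, \<omega>)) D > ln (1 + \<eta>) / 8))"
      using cont main by (intro exI[of _ B] conjI) auto
  qed
qed

end
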